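(* Let $n\ge2$. The skew column RSK map $\mathbf{cRSK}$ is an isomorphism of $(\widehat{\mathfrak{sl}}_n\oplus\widehat{\mathfrak{sl}}_n)$-crystals on $\bigsqcup_{\lambda,\rho\in\mathbb S}\mathrm{SST}(\lambda/\rho,n)^2$; that is, for all $G\in\{E^{(k)}_i,F^{(k)}_i:0\le i\le n-1,\ 1\le k\le2\}$, $$\mathbf{cRSK}\circ G=G\circ\mathbf{cRSK}$$ (with the convention $\mathbf{cRSK}(\mathbf 0)=\mathbf 0$).
   Context: A signature of length $\ell\ge0$ is a sequence of integers $\lambda=(\lambda_1\ge\dots\ge\lambda_\ell)$; $\mathbb S_\ell$ is the set of these, $\mathbb S=\bigsqcup_{\ell\ge0}\mathbb S_\ell$. Conjugate: $\lambda'_x=\#\{j:\lambda_j\ge x\}$, $x\in\mathbb Z$. $\kappa\preceq\mu$ (same length) means $\mu_1\ge\kappa_1\ge\mu_2\ge\kappa_2\ge\cdots$, equivalently $\mu'_x-\kappa'_x\in\{0,1\}$ for all $x$. For $\kappa\preceq\mu$, $\kappa\preceq\lambda$ in $\mathbb S_\ell$ put $a_x=\mu'_x-\kappa'_x$, $b_x=\lambda'_x-\kappa'_x$, $c_x=\max\{0,a_x+b_x+c_{x-1}-1\}$ with $c_x=0$ for $x\ll0$; $\overline{\mathsf F}(\kappa,\mu,\lambda)=\nu\in\mathbb S_\ell$ is given by $\nu'_x=\mu'_x+\lambda'_x-\kappa'_x+c_{x-1}-c_x$. $\mathscr C_n=\mathbb Z^2/\sim$, $(x,y)\sim(x+kn,y-kn)$,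 $k\in\mathbb Z$. A Fomin field is a map $\boldsymbol\lambda:\mathscr C_n\to\mathbb S_\ell$ with $\boldsymbol\lambda(p)\preceq\boldsymbol\lambda(p+\mathbf e_i)$ ($i=1,2$) and $\boldsymbol\lambda(p+\mathbf e_1+\mathbf e_2)=\overline{\mathsf F}(\boldsymbol\lambda(p),\boldsymbol\lambda(p+\mathbf e_1),\boldsymbol\lambda(p+\mathbf e_2))$. For $\rho,\lambda$ of the same length, $P\in\mathrm{SST}(\lambda/\rho,n)$ is a chain $\rho=\lambda^{(0)}\preceq\dots\preceq\lambda^{(n)}=\lambda$; equivalently a filling where cells $(j,k)$ (row $j$, column $k$) with $\lambda^{(i-1)}_j<k\le\lambda^{(i)}_j$ have label $i$. For $P=(\lambda^{(i)})_i$, $Q=(\mu^{(i)})_i$ in $\mathrm{SST}(\lambda/\rho,n)$, $\boldsymbol\lambda[P,Q]$ is the unique Fomin field on $\mathscr C_n$ with $\boldsymbol\lambda(i,0)=\lambda^{(i)}$, $\boldsymbol\lambda(0,i)=\mu^{(i)}$, $0\le i\le n$. With $\boldsymbol\lambda=\boldsymbol\lambda[P,Q]$ define the (invertible) maps $\iota_1(P,Q)=\big((\boldsymbol\lambda(1+i,0))_{i=0}^n,(\boldsymbol\lambda(1,i))_{i=0}^n\big)$, $\iota_2(P,Q)=\big((\boldsymbol\lambda(i,1))_{i=0}^n,(\boldsymbol\lambda(0,1+i))_{i=0}^n\big)$, $\mathbf{cRSK}(P,Q)=\big((\boldsymbol\lambda(n+i,0))_{i=0}^n,(\boldsymbol\lambda(n,i))_{i=0}^n\big)$.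 Kashiwara operators. For $1\le i\le n-1$ and a tableau $P$, take its row reading word (rows concatenated from bottom to top), replace each $i$ by ")" and each $i+1$ by "(", ignore other letters, delete successively adjacent pairs "(" ")" until the remaining string is $)\cdots)(\cdots($. $e_i(P)$ changes the $i+1$ of the leftmost remaining "(" into $i$ ($\mathbf 0$ if none); $f_i(P)$ changes the $i$ of the rightmost remaining ")" into $i+1$ ($\mathbf 0$ if none). On pairs, for $1\le i\le n-1$: $E^{(1)}_i=e_i\times\mathbf 1$, $F^{(1)}_i=f_i\times\mathbf 1$, $E^{(2)}_i=\mathbf 1\times e_i$, $F^{(2)}_i=\mathbf 1\times f_i$; and $E^{(k)}_0=\iota_k\circ E^{(k)}_1\circ\iota_k^{-1}$, $F^{(k)}_0=\iota_k\circ F^{(k)}_1\circ\iota_k^{-1}$ for $k=1,2$. *)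

theory Defs
  imports Main
begin

section \<open>Signatures and the local rule\<close>

text \<open>Signatures are integer lists; rows are indexed from 0, columns are integers.\<close>

definition signature :: "int list \<Rightarrow> bool" where
  "signature l \<longleftrightarrow> sorted_wrt (\<ge>) l"

definition conj_sig :: "int list \<Rightarrow> int \<Rightarrow> int" where
  "conj_sig l x = int (card {j. j < length l \<and> x \<le> l ! j})"

text \<open>\<open>interlace \<kappa> \<mu>\<close> is the relation
  \<open>\<mu>\<^sub>1 \<ge> \<kappa>\<^sub>1 \<ge> \<mu>\<^sub>2 \<ge> \<kappa>\<^sub>2 \<ge> \<dots>\<close> between signatures of the same length.\<close>

definition interlace :: "int list \<Rightarrow> int list \<Rightarrow> bool" where
  "interlace \<kappa> \<mu> \<longleftrightarrow> length \<kappa> = length \<mu> \<and>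
     (\<forall>j<length \<kappa>. \<kappa> ! j \<le> \<mu> ! j) \<and>
     (\<forall>j. Suc j < length \<kappa> \<longrightarrow> \<mu> ! Suc j \<le> \<kappa> ! j)"

text \<open>The carry sequence: the recursion runs upwards in \<open>x\<close>, and is started by the requirement
  that the sequence vanishes near \<open>-\<infinity>\<close>; this determines it uniquely.\<close>

definition carry :: "int list \<Rightarrow> int list \<Rightarrow> int list \<Rightarrow> int \<Rightarrow> int" where
  "carry \<kappa> \<mu> l = (THE c.
     (\<forall>x. c x = max 0 ((conj_sig \<mu> x - conj_sig \<kappa> x) + (conj_sig l x - conj_sig \<kappa> x)
                        + c (x - 1) - 1)) \<and>
     (\<exists>N. \<forall>x\<le>N. c x = 0))"

definition Fomin_rule :: "int list \<Rightarrow> int list \<Rightarrow> int list \<Rightarrow> int list" where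
  "Fomin_rule \<kappa> \<mu> l = (THE \<nu>. signature \<nu> \<and> length \<nu> = length \<kappa> \<and>
     (\<forall>x. conj_sig \<nu> x = conj_sig \<mu> x + conj_sig l x - conj_sig \<kappa> x
                          + carry \<kappa> \<mu> l (x - 1) - carry \<kappa> \<mu> l x))"

section \<open>Fomin fields on the cylinder\<close>

definition cylinder_rel :: "nat \<Rightarrow> ((int \<times> int) \<times> (int \<times> int)) set" where
  "cylinder_rel n = {((x, y), (x + k * int n, y - k * int n)) | x y k. True}"

text \<open>A map on the quotient of \<open>\<int> \<times> \<int>\<close> by \<^term>\<open>cylinder_rel n\<close> is represented by a map on
  \<open>\<int> \<times> \<int>\<close> that is constant on the equivalence classes.\<close>

definition Fomin_field :: "nat \<Rightarrow> nat \<Rightarrow> (int \<times> int \<Rightarrow> int list) \<Rightarrow> bool" where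
  "Fomin_field n len F \<longleftrightarrow> F respects (cylinder_rel n) \<and>
     (\<forall>p. signature (F p) \<and> length (F p) = len) \<and>
     (\<forall>x y. interlace (F (x, y)) (F (x + 1, y)) \<and> interlace (F (x, y)) (F (x, y + 1)) \<and>
            F (x + 1, y + 1) = Fomin_rule (F (x, y)) (F (x + 1, y)) (F (x, y + 1)))"

section \<open>Semistandard tableaux as chains\<close>

definition SST :: "int list \<Rightarrow> int list \<Rightarrow> nat \<Rightarrow> int list list set" where
  "SST \<rho> l n = {P. length P = n + 1 \<and> P ! 0 = \<rho> \<and> P ! n = l \<and>
     (\<forall>i\<le>n. signature (P ! i)) \<and> (\<forall>i<n. interlace (P ! i) (P ! (i + 1)))}"

type_synonym tableau_pair = "int list list \<times> int list list"

definition SST_pairs :: "nat \<Rightarrow> tableau_pair set" where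
  "SST_pairs n = (\<Union>\<rho>\<in>{\<rho>. signature \<rho>}. \<Union>l\<in>{l. signature l}. SST \<rho> l n \<times> SST \<rho> l n)"

definition field_of :: "nat \<Rightarrow> tableau_pair \<Rightarrow> int \<times> int \<Rightarrow> int list" where
  "field_of n PQ = (case PQ of (P, Q) \<Rightarrow>
     (THE F. Fomin_field n (length (P ! 0)) F \<and>
        (\<forall>i\<le>n. F (int i, 0) = P ! i \<and> F (0, int i) = Q ! i)))"

definition iota1 :: "nat \<Rightarrow> tableau_pair \<Rightarrow> tableau_pair" where
  "iota1 n PQ = (map (\<lambda>i. field_of n PQ (1 + int i, 0)) [0..<n+1],
                 map (\<lambda>i. field_of n PQ (1, int i)) [0..<n+1])"

definition iota2 :: "nat \<Rightarrow> tableau_pair \<Rightarrow> tableau_pair" where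
  "iota2 n PQ = (map (\<lambda>i. field_of n PQ (int i, 1)) [0..<n+1],
                 map (\<lambda>i. field_of n PQ (0, 1 + int i)) [0..<n+1])"

definition cRSK :: "nat \<Rightarrow> tableau_pair \<Rightarrow> tableau_pair" where
  "cRSK n PQ = (map (\<lambda>i. field_of n PQ (int n + int i, 0)) [0..<n+1],
                map (\<lambda>i. field_of n PQ (int n, int i)) [0..<n+1])"

section \<open>Kashiwara operators on tableaux\<close>

text \<open>The element \<open>\<zero>\<close> of a crystal is rendered by \<^term>\<open>None\<close>.\<close>

type_synonym cell = "nat \<times> int"

text \<open>The cells of the skew shape in row reading order: rows from bottom to top, each row from
  left to right.\<close>

definition reading_cells :: "int list \<Rightarrow> int list \<Rightarrow> cell list" where
  "reading_cells \<rho> l =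
     concat (map (\<lambda>j. map (\<lambda>k. (j, k)) [\<rho> ! j + 1 .. l ! j]) (rev [0..<length \<rho>]))"

definition filling :: "int list list \<Rightarrow> cell \<Rightarrow> nat option" where
  "filling P = (\<lambda>(j, k).
     if j < length (hd P) \<and> hd P ! j < k \<and> k \<le> last P ! j
     then Some (THE i. 1 \<le> i \<and> i < length P \<and> P ! (i - 1) ! j < k \<and> k \<le> P ! i ! j)
     else None)"

text \<open>Cells labelled \<open>i\<close> are closing brackets and cells labelled \<open>i + 1\<close> are opening brackets.
  The word is built up from its right end; whenever a new opening bracket is put directly in
  front of a closing one, this adjacent pair is deleted.\<close>

definition remaining_brackets :: "nat \<Rightarrow> int list list \<Rightarrow> cell list" where
  "remaining_brackets i P =
     foldr (\<lambda>c w. if filling P c = Some (i + 1) \<and> w \<noteq> [] \<and> filling P (hd w) = Some i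
                  then tl w else c # w)
       (filter (\<lambda>c. filling P c \<in> {Some i, Some (i + 1)}) (reading_cells (hd P) (last P))) []"

definition relabel :: "nat \<Rightarrow> int list list \<Rightarrow> cell \<Rightarrow> nat \<Rightarrow> int list list" where
  "relabel n P c i =
     (THE P'. P' \<in> SST (hd P) (last P) n \<and> filling P' = (filling P)(c \<mapsto> i))"

definition kash_e :: "nat \<Rightarrow> nat \<Rightarrow> int list list \<Rightarrow> int list list option" where
  "kash_e n i P = map_option (\<lambda>c. relabel n P c i)
     (find (\<lambda>c. filling P c = Some (i + 1)) (remaining_brackets i P))"

definition kash_f :: "nat \<Rightarrow> nat \<Rightarrow> int list list \<Rightarrow> int list list option" where
  "kash_f n i P = map_option (\<lambda>c. relabel n P c (i + 1))
     (find (\<lambda>c. filling P c = Some i) (rev (remaining_brackets i P)))"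

section \<open>Affine bicrystal operators on pairs\<close>

definition on_fst :: "('a \<Rightarrow> 'a option) \<Rightarrow> 'a \<times> 'b \<Rightarrow> ('a \<times> 'b) option" where
  "on_fst g PQ = map_option (\<lambda>P'. (P', snd PQ)) (g (fst PQ))"

definition on_snd :: "('b \<Rightarrow> 'b option) \<Rightarrow> 'a \<times> 'b \<Rightarrow> ('a \<times> 'b) option" where
  "on_snd g PQ = map_option (\<lambda>Q'. (fst PQ, Q')) (g (snd PQ))"

definition conjugate_by ::
  "nat \<Rightarrow> (tableau_pair \<Rightarrow> tableau_pair) \<Rightarrow> (tableau_pair \<Rightarrow> tableau_pair option)
     \<Rightarrow> tableau_pair \<Rightarrow> tableau_pair option" where
  "conjugate_by n \<iota> G PQ = map_option \<iota> (G (inv_into (SST_pairs n) \<iota> PQ))"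

definition E1 :: "nat \<Rightarrow> nat \<Rightarrow> tableau_pair \<Rightarrow> tableau_pair option" where
  "E1 n i = (if i = 0 then conjugate_by n (iota1 n) (on_fst (kash_e n 1))
             else on_fst (kash_e n i))"

definition F1 :: "nat \<Rightarrow> nat \<Rightarrow> tableau_pair \<Rightarrow> tableau_pair option" where
  "F1 n i = (if i = 0 then conjugate_by n (iota1 n) (on_fst (kash_f n 1))
             else on_fst (kash_f n i))"

definition E2 :: "nat \<Rightarrow> nat \<Rightarrow> tableau_pair \<Rightarrow> tableau_pair option" where
  "E2 n i = (if i = 0 then conjugate_by n (iota2 n) (on_snd (kash_e n 1))
             else on_snd (kash_e n i))"

definition F2 :: "nat \<Rightarrow> nat \<Rightarrow> tableau_pair \<Rightarrow> tableau_pair option" where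
  "F2 n i = (if i = 0 then conjugate_by n (iota2 n) (on_snd (kash_f n 1))
             else on_snd (kash_f n i))"

end

theory Submission
  imports Defs
begin

text \<open>
  Read row by row from the bottom, the local rule is a queue: with carries \<open>D\<close> one has
  \<open>\<mu>\<^sub>j + l\<^sub>j + D\<^sub>j\<^sub>+\<^sub>1 = \<nu>\<^sub>j + \<kappa>\<^sub>j + D\<^sub>j\<close>, and a carry is positive only where \<open>\<nu>\<^sub>j = \<kappa>\<^sub>j\<^sub>-\<^sub>1\<close>.
  This relation is deterministic in both directions, so pairs of tableaux are the same as fields on
  the cylinder, and the maps \<open>\<iota>\<^sub>1\<close>, \<open>\<iota>\<^sub>2\<close> and cRSK become translations of fields.

  The operator \<open>f\<^sub>i\<close> lowers the entry of the middle signature of \<open>\<kappa>\<^sub>0 \<preceq> \<kappa>\<^sub>1 \<preceq> \<kappa>\<^sub>2\<close> in the bottommost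
  row that maximizes the excess of closing over opening brackets. Along two adjacent squares this
  excess and the one of the upper signatures differ from a common function by the two carries, which
  identifies both maximizing rows, and moving one unit through the carries between them shows that
  lowering below forces lowering above and leaves the other signatures unchanged. Hence \<open>f\<^sub>i\<close> acts on a
  field by lowering all columns \<open>x\<close> congruent to \<open>i\<close> modulo \<open>n\<close> simultaneously, an operation that
  commutes with translation by \<open>n\<close>. The operators \<open>e\<^sub>i\<close> are the partial inverses of the \<open>f\<^sub>i\<close>, those of
  index 0 are conjugates by translations, and those on the second component come from transposing
  the field.
\<close>

section \<open>The local rule in terms of rows\<close>

text \<open>\<open>D j\<close> is the overflow that row \<open>j\<close> hands to row
  \<open>j - 1\<close>: nothing enters the bottom row and nothing leaves the top row. Giving the
  carries as a witness with a complementarity condition lets one relation be solved for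
  \<open>\<nu>\<close> from the bottom row and for \<open>\<kappa>\<close> from the top row.\<close>

definition local_rule :: "int list \<Rightarrow> int list \<Rightarrow> int list \<Rightarrow> int list \<Rightarrow> bool" where
  "local_rule \<kappa> \<mu> l \<nu> \<longleftrightarrow> length \<mu> = length \<kappa> \<and> length l = length \<kappa> \<and> length \<nu> = length \<kappa> \<and>
     (\<exists>D. D 0 = 0 \<and> D (length \<kappa>) = 0 \<and> (\<forall>j. 0 \<le> D j) \<and>
       (\<forall>j<length \<kappa>. \<mu> ! j + l ! j + D (Suc j) = \<nu> ! j + \<kappa> ! j + D j) \<and>
       (\<forall>j. Suc j < length \<kappa> \<longrightarrow> \<nu> ! Suc j \<le> \<kappa> ! j \<and> (D (Suc j) = 0 \<or> \<nu> ! Suc j = \<kappa> ! j)))"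

lemma local_rule_sym: "local_rule \<kappa> \<mu> l \<nu> \<Longrightarrow> local_rule \<kappa> l \<mu> \<nu>"
  unfolding local_rule_def by (auto simp: add.commute)

lemma interlace_length: "interlace \<kappa> \<mu> \<Longrightarrow> length \<mu> = length \<kappa>"
  by (simp add: interlace_def)

lemma interlace_nth_le: "interlace \<kappa> \<mu> \<Longrightarrow> j < length \<kappa> \<Longrightarrow> \<kappa> ! j \<le> \<mu> ! j"
  by (simp add: interlace_def)

lemma signatureI:
  assumes "\<And>j. Suc j < length l \<Longrightarrow> l ! Suc j \<le> l ! j"
  shows "signature l"
proof -
  have "i + d < length l \<Longrightarrow> l ! (i + d) \<le> l ! i" for i d
  proof (induction d)
    case (Suc d)
    then show ?case using assms[of "i + d"] by auto
  qed simp
  then show ?thesis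
    unfolding signature_def sorted_wrt_iff_nth_less by (metis less_imp_add_positive)
qed

lemma signature_mono: "signature l \<Longrightarrow> i \<le> j \<Longrightarrow> j < length l \<Longrightarrow> l ! j \<le> l ! i"
  unfolding signature_def sorted_wrt_iff_nth_less by (cases "i = j") auto

lemma interlace_signature:
  assumes "interlace \<kappa> \<mu>"
  shows "signature \<kappa>" "signature \<mu>"
proof -
  show "signature \<kappa>"
    using assms by (intro signatureI) (metis interlace_def order.trans)
  show "signature \<mu>"
    using assms by (intro signatureI) (metis interlace_def order.trans Suc_lessD)
qed

text \<open>Carries run from the bottom row to the top, against the order of the indices; counting
  by \<open>N - j\<close> reduces this to \<open>rec_nat\<close>.\<close>

lemma downward_recursion:
  "\<exists>D. D N = z \<and> (\<forall>j<N. D j = g j (D (Suc j)))"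
proof -
  let ?D = "\<lambda>j. rec_nat z (\<lambda>m. g (N - Suc m)) (N - j)"
  have "?D j = g j (?D (Suc j))" if "j < N" for j
  proof -
    from that
have "N - j = Suc (N - Suc j)" "N - Suc (N - Suc j) = j" by auto
    then show ?thesis by simp
  qed
  then show ?thesis by (intro exI[of _ ?D]) simp
qed

text \<open>Below the top row, \<open>\<nu> ! j\<close> is capped by
  \<open>\<kappa> ! (j - 1)\<close>, and whatever exceeds the cap becomes the carry to the next row
  up. Interlacing survives the cap because \<open>\<mu> ! j\<close> and \<open>l ! j\<close> do not
  exceed it.\<close>

lemma local_rule_exists:
  assumes "interlace \<kappa> \<mu>" "interlace \<kappa> l"
  shows "\<exists>\<nu>. local_rule \<kappa> \<mu> l \<nu> \<and> interlace \<mu> \<nu> \<and> interlace l \<nu>"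
proof -
  let ?n = "length \<kappa>"
  obtain D where D0: "D ?n = (0::int)"
    and D: "\<And>j. j < ?n \<Longrightarrow> D j = (if j = 0 then 0
          else max 0 (\<mu> ! j + l ! j - \<kappa> ! j + D (Suc j) - \<kappa> ! (j - 1)))"
    using downward_recursion[of ?n 0 "\<lambda>j d. if j = 0 then 0
          else max 0 (\<mu> ! j + l ! j - \<kappa> ! j + d - \<kappa> ! (j - 1))"] by blast
  \<comment> \<open>The recursion is silent beyond the last row, whereas \<open>local_rule\<close>
    asks for nonnegative carries at every index.\<close>
  define E where "E j = (if j \<le> ?n then D j else 0)" for j
  define \<nu> where "\<nu> = map (\<lambda>j. \<mu> ! j + l ! j - \<kappa> ! j + E (Suc j) - E j) [0..<?n]"
  have nonneg: "0 \<le> E j" for j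
    using D[of j] D0 by (cases "j < ?n"; cases "j = ?n") (auto simp: E_def)
  have E0: "E 0 = 0" using D[of 0] D0 by (cases "?n = 0") (auto simp: E_def)
  have EN: "E ?n = 0" using D0 by (simp add: E_def)
  have nu: "\<nu> ! j = \<mu> ! j + l ! j - \<kappa> ! j + E (Suc j) - E j" if "j < ?n" for j
    using that by (simp add: \<nu>_def)
  have E: "E (Suc j) = max 0 (\<mu> ! Suc j + l ! Suc j - \<kappa> ! Suc j + E (Suc (Suc j)) - \<kappa> ! j)"
    if "Suc j < ?n" for j
    using that D[of "Suc j"] by (simp add: E_def)
  have len: "length \<nu> = ?n" "length \<mu> = ?n" "length l = ?n"
    using assms by (auto simp: \<nu>_def interlace_length)
  have nuS: "\<nu> ! Suc j = min (\<kappa> ! j) (\<mu> ! Suc j + l ! Suc j - \<kappa> ! Suc j + E (Suc (Suc j)))"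
    if "Suc j < ?n" for j
    using nu[OF that] E[OF that] by (auto simp: max_def min_def)
  have "local_rule \<kappa> \<mu> l \<nu>"
    unfolding local_rule_def using len E0 EN nonneg
    by (intro conjI exI[of _ E]) (auto simp: nu nuS E min_def max_def)
  moreover have "\<mu> ! j \<le> \<nu> ! j \<and> l ! j \<le> \<nu> ! j" if "j < ?n" for j
  proof (cases j)
    case 0
    moreover have "\<kappa> ! 0 \<le> \<mu> ! 0" "\<kappa> ! 0 \<le> l ! 0" using 0 assms that by (auto simp: interlace_def)
    ultimately show ?thesis using nu[of 0] E0 nonneg[of 1] that by auto
  next
    case (Suc i)
    then show ?thesis using nuS[of i] nonneg[of "Suc j"] assms that
      by (auto simp: interlace_def min_def)
  qed
  moreover have "\<nu> ! Suc j \<le> \<mu> ! j \<and> \<nu> ! Suc j \<le> l ! j" if "Suc j < ?n" for j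
    using nuS[OF that] assms that unfolding interlace_def by (auto simp: min_le_iff_disj)
  ultimately show ?thesis using len by (auto simp: interlace_def)
qed

text \<open>The queue is run from the top: \<open>\<kappa> ! j\<close> is the maximum of
  \<open>\<nu> ! Suc j\<close> and what row \<open>j\<close> leaves after paying the carry
  \<open>E j\<close>, and the shortfall of the latter is the carry demanded from the row below. The
  last row has no such floor and receives no carry.\<close>

lemma local_rule_exists_backward:
  assumes "interlace \<mu> \<nu>" "interlace l \<nu>"
  shows "\<exists>\<kappa>. local_rule \<kappa> \<mu> l \<nu> \<and> interlace \<kappa> \<mu> \<and> interlace \<kappa> l"
proof -
  let ?n = "length \<nu>"
  define E :: "nat \<Rightarrow> int" where
    "E = rec_nat 0 (\<lambda>j d. if Suc j < ?n then max 0 (\<nu> ! Suc j - (\<mu> ! j + l ! j - \<nu> ! j - d)) else 0)"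
  define \<kappa> where "\<kappa> = map (\<lambda>j. \<mu> ! j + l ! j - \<nu> ! j + E (Suc j) - E j) [0..<?n]"
  have E0: "E 0 = 0" by (simp add: E_def)
  have ES: "E (Suc j) = (if Suc j < ?n then max 0 (\<nu> ! Suc j - (\<mu> ! j + l ! j - \<nu> ! j - E j)) else 0)"
    for j by (simp add: E_def)
  have nonneg: "0 \<le> E j" for j using E0 ES by (cases j) auto
  have EN: "E ?n = 0" using E0 ES by (cases ?n) auto
  have len: "length \<kappa> = ?n" "length \<mu> = ?n" "length l = ?n"
    using assms by (auto simp: \<kappa>_def interlace_def)
  have ka: "\<kappa> ! j = \<mu> ! j + l ! j - \<nu> ! j + E (Suc j) - E j" if "j < ?n" for j
    using that by (simp add: \<kappa>_def)
  have kaS: "\<kappa> ! j = max (\<nu> ! Suc j) (\<mu> ! j + l ! j - \<nu> ! j - E j)" if "Suc j < ?n" for j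
    using that ka[of j] ES[of j] by (auto simp: max_def)
  have "local_rule \<kappa> \<mu> l \<nu>"
    unfolding local_rule_def using len E0 EN nonneg
    by (intro conjI exI[of _ E]) (auto simp: ka kaS ES max_def)
  moreover have "\<kappa> ! j \<le> \<mu> ! j \<and> \<kappa> ! j \<le> l ! j" if "j < ?n" for j
  proof (cases "Suc j < ?n")
    case True
    moreover have "\<mu> ! j \<le> \<nu> ! j" "l ! j \<le> \<nu> ! j" "\<nu> ! Suc j \<le> \<mu> ! j" "\<nu> ! Suc j \<le> l ! j"
      using assms True by (auto simp: interlace_def)
    ultimately show ?thesis using kaS[of j] nonneg[of j] by auto
  next
    case False
    moreover have "\<mu> ! j \<le> \<nu> ! j" "l ! j \<le> \<nu> ! j"
      using assms that by (auto simp: interlace_def)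
    ultimately show ?thesis using ka[OF that] ES[of j] nonneg[of j] by auto
  qed
  moreover have "\<mu> ! Suc j \<le> \<kappa> ! j \<and> l ! Suc j \<le> \<kappa> ! j" if "Suc j < ?n" for j
    using kaS[OF that] assms that unfolding interlace_def by (auto simp: le_max_iff_disj)
  ultimately show ?thesis using len by (auto simp: interlace_def)
qed

text \<open>Going up from the bottom, the incoming carry fixes \<open>\<nu> ! j + D j\<close>, and
  complementarity admits only one splitting of this sum: the part beyond the cap is the
  carry.\<close>

lemma local_rule_unique:
  assumes "local_rule \<kappa> \<mu> l \<nu>" "local_rule \<kappa> \<mu> l \<nu>'"
  shows "\<nu> = \<nu>'"
proof -
  let ?n = "length \<kappa>"
  obtain D where D: "D 0 = 0" "D ?n = 0" "\<And>j. 0 \<le> D j"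
    "\<And>j. j < ?n \<Longrightarrow> \<mu> ! j + l ! j + D (Suc j) = \<nu> ! j + \<kappa> ! j + D j"
    "\<And>j. Suc j < ?n \<Longrightarrow> \<nu> ! Suc j \<le> \<kappa> ! j \<and> (D (Suc j) = 0 \<or> \<nu> ! Suc j = \<kappa> ! j)"
    using assms(1) unfolding local_rule_def by blast
  obtain D' where D': "D' 0 = 0" "D' ?n = 0" "\<And>j. 0 \<le> D' j"
    "\<And>j. j < ?n \<Longrightarrow> \<mu> ! j + l ! j + D' (Suc j) = \<nu>' ! j + \<kappa> ! j + D' j"
    "\<And>j. Suc j < ?n \<Longrightarrow> \<nu>' ! Suc j \<le> \<kappa> ! j \<and> (D' (Suc j) = 0 \<or> \<nu>' ! Suc j = \<kappa> ! j)"
    using assms(2) unfolding local_rule_def by blast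
  have eq: "D j = D' j" if "j \<le> ?n" for j
    using that
  proof (induction rule: inc_induct)
    case base then show ?case using D(2) D'(2) by simp
  next
    case (step j)
    then show ?case
      using D(1) D'(1) D(3)[of j] D'(3)[of j] D(4)[of j] D'(4)[of j] D(5)[of "j - 1"] D'(5)[of "j - 1"]
      by (cases j) auto
  qed
  have "\<nu> ! j = \<nu>' ! j" if "j < ?n" for j
    using D(4)[OF that] D'(4)[OF that] eq[of j] eq[of "Suc j"] that by simp
  then show ?thesis using assms by (auto simp: local_rule_def intro: nth_equalityI)
qed

text \<open>Going down from the top, the outgoing carry fixes
  \<open>\<kappa> ! j - D (Suc j)\<close>, and complementarity with the floor
  \<open>\<nu> ! Suc j\<close> determines both terms.\<close>

lemma local_rule_unique_backward:
  assumes "local_rule \<kappa> \<mu> l \<nu>" "local_rule \<kappa>' \<mu> l \<nu>"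
  shows "\<kappa> = \<kappa>'"
proof -
  let ?n = "length \<kappa>"
  have n: "length \<kappa>' = ?n" using assms by (simp add: local_rule_def)
  obtain D where D: "D 0 = 0" "D ?n = 0" "\<And>j. 0 \<le> D j"
    "\<And>j. j < ?n \<Longrightarrow> \<mu> ! j + l ! j + D (Suc j) = \<nu> ! j + \<kappa> ! j + D j"
    "\<And>j. Suc j < ?n \<Longrightarrow> \<nu> ! Suc j \<le> \<kappa> ! j \<and> (D (Suc j) = 0 \<or> \<nu> ! Suc j = \<kappa> ! j)"
    using assms(1) unfolding local_rule_def by blast
  obtain D' where D': "D' 0 = 0" "D' ?n = 0" "\<And>j. 0 \<le> D' j"
    "\<And>j. j < ?n \<Longrightarrow> \<mu> ! j + l ! j + D' (Suc j) = \<nu> ! j + \<kappa>' ! j + D' j"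
    "\<And>j. Suc j < ?n \<Longrightarrow> \<nu> ! Suc j \<le> \<kappa>' ! j \<and> (D' (Suc j) = 0 \<or> \<nu> ! Suc j = \<kappa>' ! j)"
    using assms(2) unfolding local_rule_def n by blast
  have eq: "D j = D' j" if "j \<le> ?n" for j
    using that
  proof (induction j)
    case 0 then show ?case using D(1) D'(1) by simp
  next
    case (Suc j)
    then show ?case
      using D(2) D'(2) D(3)[of "Suc j"] D'(3)[of "Suc j"] D(4)[of j] D'(4)[of j] D(5)[of j] D'(5)[of j]
      by (cases "Suc j = ?n") auto
  qed
  have "\<kappa> ! j = \<kappa>' ! j" if "j < ?n" for j
    using D(4)[OF that] D'(4)[OF that] eq[of j] eq[of "Suc j"] that by simp
  then show ?thesis using n by (auto intro: nth_equalityI)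
qed

lemma local_rule_interlace:
  assumes "interlace \<kappa> \<mu>" "interlace \<kappa> l" "local_rule \<kappa> \<mu> l \<nu>"
  shows "interlace \<mu> \<nu>" "interlace l \<nu>"
  using local_rule_exists[OF assms(1,2)] local_rule_unique[OF assms(3)] by blast+

section \<open>Comparison with the carry sequence\<close>

lemma conj_sig_sum: "conj_sig l x = (\<Sum>j<length l. if x \<le> l ! j then 1 else 0)"
proof -
  have "{j. j < length l \<and> x \<le> l ! j} = {j \<in> {..<length l}. x \<le> l ! j}" by auto
  then show ?thesis unfolding conj_sig_def by (simp add: sum.If_cases Int_def)
qed

text \<open>The rows that reach column \<open>x\<close> form an initial segment whose size is the
  length of that column.\<close>

lemma signature_le_nth_iff:
  assumes "signature l" "j < length l"
  shows "x \<le> l ! j \<longleftrightarrow> int j < conj_sig l x"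
proof
  assume "x \<le> l ! j"
  then have "x \<le> l ! i" if "i \<le> j" for i using signature_mono[OF assms(1) that assms(2)] by simp
  then have "{..j} \<subseteq> {i. i < length l \<and> x \<le> l ! i}" using assms(2) by auto
  from card_mono[OF _ this] show "int j < conj_sig l x" by (simp add: conj_sig_def)
next
  assume less: "int j < conj_sig l x"
  show "x \<le> l ! j"
  proof (rule ccontr)
    assume "\<not> x \<le> l ! j"
    then have "{i. i < length l \<and> x \<le> l ! i} \<subseteq> {..<j}"
      using signature_mono[OF assms(1)] by (force simp: not_less[symmetric])
    from card_mono[OF _ this] less show False by (simp add: conj_sig_def)
  qed
qed

lemma signature_eqI:
  assumes "signature l" "signature l'" "length l = length l'" "\<And>x. conj_sig l x = conj_sig l' x"
  shows "l = l'"
proof (rule nth_equalityI)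
  fix j assume "j < length l"
  then have "x \<le> l ! j \<longleftrightarrow> x \<le> l' ! j" for x
    using signature_le_nth_iff[OF assms(1)] signature_le_nth_iff[OF assms(2)] assms(3,4) by simp
  then show "l ! j = l' ! j" by (meson order.antisym order.refl)
qed (rule assms(3))

lemma carry_recursion_unique:
  fixes c c' :: "int \<Rightarrow> int"
  assumes "\<And>x. c x = max 0 (g x + c (x - 1) - 1)" "\<exists>N. \<forall>x\<le>N. c x = 0"
    and "\<And>x. c' x = max 0 (g x + c' (x - 1) - 1)" "\<exists>N. \<forall>x\<le>N. c' x = 0"
  shows "c = c'"
proof
  fix x
  obtain N where "\<And>x. x \<le> N \<Longrightarrow> c x = 0" using assms(2) by blast
  moreover obtain N' where "\<And>x. x \<le> N' \<Longrightarrow> c' x = 0" using assms(4) by blast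
  ultimately have eq: "c y = c' y" if "y \<le> min N N'" for y using that by simp
  show "c x = c' x"
  proof (cases "x \<le> min N N'")
    case False
    then have "min N N' \<le> x" by linarith
    then show ?thesis
    proof (induction x rule: int_ge_induct)
      case (step i)
      then show ?case using assms(1)[of "i + 1"] assms(3)[of "i + 1"] by simp
    qed (simp add: eq)
  qed (rule eq)
qed

text \<open>Summing the defining equation of the rule over all columns beyond \<open>x\<close> gives the closed form
  of the carry used here.\<close>

lemma local_rule_conj_sig:
  assumes \<kappa>\<mu>: "interlace \<kappa> \<mu>" and \<kappa>l: "interlace \<kappa> l" and rule: "local_rule \<kappa> \<mu> l \<nu>"
  shows "conj_sig \<nu> x = conj_sig \<mu> x + conj_sig l x - conj_sig \<kappa> x
           + carry \<kappa> \<mu> l (x - 1) - carry \<kappa> \<mu> l x"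
proof -
  let ?n = "length \<kappa>"
  have len: "length \<mu> = ?n" "length l = ?n" "length \<nu> = ?n"
    using rule by (auto simp: local_rule_def)
  obtain D where D: "D 0 = 0" "D ?n = 0" "\<And>j. 0 \<le> D j"
    "\<And>j. j < ?n \<Longrightarrow> \<mu> ! j + l ! j + D (Suc j) = \<nu> ! j + \<kappa> ! j + D j"
    "\<And>j. Suc j < ?n \<Longrightarrow> \<nu> ! Suc j \<le> \<kappa> ! j \<and> (D (Suc j) = 0 \<or> \<nu> ! Suc j = \<kappa> ! j)"
    using rule unfolding local_rule_def by blast
  note \<mu>\<nu> = local_rule_interlace(1)[OF assms] and l\<nu> = local_rule_interlace(2)[OF assms]
  have sig: "signature \<kappa>" using \<kappa>\<mu> by (rule interlace_signature)
  have le: "\<kappa> ! j \<le> \<mu> ! j" "\<kappa> ! j \<le> l ! j" "\<mu> ! j \<le> \<nu> ! j" "l ! j \<le> \<nu> ! j" if "j < ?n" for j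
    using that \<kappa>\<mu> \<kappa>l \<mu>\<nu> l\<nu> by (auto simp: interlace_def)
  \<comment> \<open>The positive part \<open>max 0 (a - x)\<close> counts the columns
    \<open>y\<close> with \<open>x < y \<le> a\<close>. Hence \<open>c x\<close> is the sum over all
    columns \<open>y > x\<close> of \<open>conj_sig \<nu> y + conj_sig \<kappa> y - conj_sig \<mu> y
    - conj_sig l y\<close>.\<close>
  define g where "g x j = max 0 (\<nu> ! j - x) + max 0 (\<kappa> ! j - x) - max 0 (\<mu> ! j - x) - max 0 (l ! j - x)"
    for x j
  define c where "c x = (\<Sum>j<?n. g x j)" for x
  have c_diff: "c (x - 1) - c x = conj_sig \<nu> x + conj_sig \<kappa> x - conj_sig \<mu> x - conj_sig l x" for x
  proof -
    have "c (x - 1) - c x = (\<Sum>j<?n. g (x - 1) j - g x j)" by (simp add: c_def sum_subtractf)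
    also have "\<dots> = (\<Sum>j<?n. (if x \<le> \<nu> ! j then 1 else 0) + (if x \<le> \<kappa> ! j then 1 else 0)
        - (if x \<le> \<mu> ! j then 1 else 0) - (if x \<le> l ! j then 1 else 0))"
      by (rule sum.cong) (auto simp: g_def max_def)
    finally show ?thesis by (simp add: conj_sig_sum len sum.distrib sum_subtractf)
  qed
  \<comment> \<open>Here \<open>j\<close> is the first row with \<open>\<kappa> ! j < x\<close>, or
    the length if there is none. Above it all four entries are at least \<open>x\<close> and the
    contributions telescope to \<open>D j\<close>; below it
    \<open>\<nu> ! t \<le> \<kappa> ! (t - 1) < x\<close> and nothing is contributed.\<close>
  have block: "c x = D j + (if j < ?n then g x j else 0) \<and>
      conj_sig \<nu> x = conj_sig \<kappa> x + (if j < ?n \<and> x \<le> \<nu> ! j then 1 else 0)"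
    if j: "j \<le> ?n" "\<And>t. t < ?n \<Longrightarrow> x \<le> \<kappa> ! t \<longleftrightarrow> t < j" for x j
  proof -
    have *: "sum h {..<?n} = sum h {..<j} + (if j < ?n then h j else 0)"
      if "\<And>t. j < t \<Longrightarrow> t < ?n \<Longrightarrow> h t = (0::int)" for h
    proof -
      have "sum h {..<?n} = sum h {..<j} + sum h {j..<?n}"
        using j(1) by (simp add: lessThan_atLeast0 sum.atLeastLessThan_concat)
      moreover have "sum h {Suc j..<?n} = 0" by (rule sum.neutral) (use that in auto)
      ultimately show ?thesis by (auto simp: sum.atLeast_Suc_lessThan)
    qed
    have above: "\<nu> ! t < x" if t: "j < t" "t < ?n" for t
    proof -
      obtain s where s: "t = Suc s" using t by (cases t) auto
      then have "\<not> x \<le> \<kappa> ! s" using t j(2)[of s] by simp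
      then show ?thesis using D(5)[of s] s t by auto
    qed
    have "(\<Sum>t<i. g x t) = D i" if "i \<le> j" for i
      using that
    proof (induction i)
      case (Suc i)
      then have "i < ?n" "x \<le> \<kappa> ! i" using j by auto
      then have "g x i = D (Suc i) - D i"
        using le[of i] D(4)[of i] by (simp add: g_def)
      then show ?case using Suc by simp
    qed (simp add: D)
    moreover have "g x t = 0" if "j < t" "t < ?n" for t
      using above[OF that] le[of t] that by (simp add: g_def)
    ultimately have "c x = D j + (if j < ?n then g x j else 0)"
      unfolding c_def using *[of "g x"] by simp
    moreover have "conj_sig \<nu> x - conj_sig \<kappa> x =
        (\<Sum>t<?n. (if x \<le> \<nu> ! t then 1 else 0) - (if x \<le> \<kappa> ! t then 1 else 0))"
      by (simp add: conj_sig_sum len sum_subtractf)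
    moreover have "\<dots> = (\<Sum>t<?n. if t = j \<and> x \<le> \<nu> ! j then 1 else 0)"
    proof (rule sum.cong)
      fix t assume "t \<in> {..<?n}"
      then show "(if x \<le> \<nu> ! t then 1 else 0) - (if x \<le> \<kappa> ! t then 1 else 0) =
          (if t = j \<and> x \<le> \<nu> ! j then 1 else (0::int))"
        using le[of t] above[of t] j(2)[of t] by (cases t j rule: linorder_cases) auto
    qed simp
    ultimately show ?thesis using j(1) by (auto simp: sum.delta)
  qed
  have ex_block: "\<exists>j\<le>?n. \<forall>t<?n. x \<le> \<kappa> ! t \<longleftrightarrow> t < j" for x
  proof (intro exI conjI allI impI)
    show "nat (conj_sig \<kappa> x) \<le> ?n"
      using card_mono[of "{..<?n}" "{j. j < ?n \<and> x \<le> \<kappa> ! j}"] by (auto simp: conj_sig_def)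
    fix t assume "t < ?n"
    then show "x \<le> \<kappa> ! t \<longleftrightarrow> t < nat (conj_sig \<kappa> x)" using signature_le_nth_iff[OF sig] by auto
  qed
  have c_rec: "c x = max 0 ((conj_sig \<mu> x - conj_sig \<kappa> x) + (conj_sig l x - conj_sig \<kappa> x) + c (x - 1) - 1)"
    for x
  proof -
    obtain j where j: "j \<le> ?n" "\<And>t. t < ?n \<Longrightarrow> x \<le> \<kappa> ! t \<longleftrightarrow> t < j" using ex_block by blast
    \<comment> \<open>Together with \<open>c_diff\<close> this dichotomy is the recursion: the
      second argument of the maximum equals \<open>c x\<close> in the first case and
      \<open>-1\<close> in the second.\<close>
    have "c x \<ge> 0 \<and> (conj_sig \<nu> x = conj_sig \<kappa> x + 1 \<or> c x = 0 \<and> conj_sig \<nu> x = conj_sig \<kappa> x)"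
    proof (cases "j < ?n \<and> x \<le> \<nu> ! j")
      case True
      then have "\<kappa> ! j < x" using j(2)[of j] by simp
      then have "0 \<le> D j + g x j"
        using True le[of j] D(3)[of j] D(3)[of "Suc j"] D(4)[of j] by (auto simp: g_def max_def)
      then show ?thesis using block[OF j] True by simp
    next
      case False
      \<comment> \<open>A positive carry out of an inner row would force
        \<open>\<nu> ! j = \<kappa> ! (j - 1)\<close>, which reaches column
        \<open>x\<close>.\<close>
      have "D j = 0"
      proof (cases "0 < j \<and> j < ?n")
        case True
        then obtain i where "j = Suc i" by (cases j) auto
        then show ?thesis using True False D(5)[of i] j(2)[of i] by auto
      qed (use D j in \<open>auto simp: le_less\<close>)
      moreover have "g x j = 0" if "j < ?n" using that False le[of j] by (simp add: g_def)
      ultimately show ?thesis using block[OF j] False by simp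
    qed
    then show ?thesis using c_diff[of x] by (auto simp: max_def)
  qed
  have c_zero: "\<exists>N. \<forall>x\<le>N. c x = 0"
  proof (intro exI allI impI)
    \<comment> \<open>Left of all entries of \<open>\<kappa>\<close> the block is the whole list, so
      \<open>c x\<close> is the carry entering the bottom row. The inserted \<open>0\<close> keeps
      the minimum defined for the empty signature.\<close>
    fix x assume x: "x \<le> Min (insert 0 (set \<kappa>))"
    have "x \<le> \<kappa> ! t" if "t < ?n" for t
    proof -
      have "Min (insert 0 (set \<kappa>)) \<le> \<kappa> ! t" using that by (intro Min_le) auto
      with x show ?thesis by (rule order.trans)
    qed
    then show "c x = 0" using block[of ?n x] D(2) by auto
  qed
  have "carry \<kappa> \<mu> l = c"
    unfolding carry_def
  proof (rule the_equality)
    fix c' assume c': "(\<forall>x. c' x = max 0 ((conj_sig \<mu> x - conj_sig \<kappa> x) + (conj_sig l x - conj_sig \<kappa> x) + c' (x - 1) - 1)) \<and>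
      (\<exists>N. \<forall>x\<le>N. c' x = 0)"
    show "c' = c"
      by (rule carry_recursion_unique[where g = "\<lambda>x. (conj_sig \<mu> x - conj_sig \<kappa> x) + (conj_sig l x - conj_sig \<kappa> x)"])
        (use c' c_rec c_zero in \<open>blast+\<close>)
  qed (use c_rec c_zero in blast)
  then show ?thesis using c_diff[of x] by simp
qed

lemma Fomin_rule_eqI:
  assumes "interlace \<kappa> \<mu>" "interlace \<kappa> l" "local_rule \<kappa> \<mu> l \<nu>"
  shows "Fomin_rule \<kappa> \<mu> l = \<nu>"
  unfolding Fomin_rule_def
proof (rule the_equality)
  have "signature \<nu>" using local_rule_interlace(1)[OF assms] interlace_signature by blast
  moreover have "length \<nu> = length \<kappa>" using assms(3) by (simp add: local_rule_def)
  ultimately show *: "signature \<nu> \<and> length \<nu> = length \<kappa> \<and>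
     (\<forall>x. conj_sig \<nu> x = conj_sig \<mu> x + conj_sig l x - conj_sig \<kappa> x
                          + carry \<kappa> \<mu> l (x - 1) - carry \<kappa> \<mu> l x)"
    using local_rule_conj_sig[OF assms] by simp
  fix \<nu>' assume "signature \<nu>' \<and> length \<nu>' = length \<kappa> \<and>
     (\<forall>x. conj_sig \<nu>' x = conj_sig \<mu> x + conj_sig l x - conj_sig \<kappa> x
                          + carry \<kappa> \<mu> l (x - 1) - carry \<kappa> \<mu> l x)"
  with * show "\<nu>' = \<nu>" by (intro signature_eqI) simp_all
qed

text \<open>This trades the column description, with its two definite descriptions, for the row
  relation, the form in which the rule is applied to fields.\<close>

lemma Fomin_rule_iff:
  assumes "interlace \<kappa> \<mu>" "interlace \<kappa> l"
  shows "\<nu> = Fomin_rule \<kappa> \<mu> l \<longleftrightarrow> local_rule \<kappa> \<mu> l \<nu>"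
  using local_rule_exists[OF assms] Fomin_rule_eqI[OF assms] local_rule_unique by metis

section \<open>Kashiwara operators and the local rule\<close>

text \<open>For three successive members of a chain, row \<open>t\<close> reads as
  \<open>\<mu> ! t - \<kappa> ! t\<close> closing brackets followed by
  \<open>\<nu> ! t - \<mu> ! t\<close> opening ones, and rows of larger index are read first. The
  value at \<open>s\<close> is closing minus opening brackets in the prefix of the word that ends
  with the closing brackets of row \<open>s\<close>.\<close>

definition bracket_excess :: "int list \<Rightarrow> int list \<Rightarrow> int list \<Rightarrow> nat \<Rightarrow> int" where
  "bracket_excess \<kappa> \<mu> \<nu> s = (\<Sum>t=s..<length \<kappa>. \<mu> ! t - \<kappa> ! t) - (\<Sum>t=Suc s..<length \<kappa>. \<nu> ! t - \<mu> ! t)"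

text \<open>Surviving closing brackets are the new positive maxima of the prefix excess. The last of
  them lies in the row read first among those of maximal excess, which is the bottommost
  one.\<close>

definition f_row :: "int list \<Rightarrow> int list \<Rightarrow> int list \<Rightarrow> nat \<Rightarrow> bool" where
  "f_row \<kappa> \<mu> \<nu> r \<longleftrightarrow> r < length \<kappa> \<and> 0 < bracket_excess \<kappa> \<mu> \<nu> r \<and>
     (\<forall>s<r. bracket_excess \<kappa> \<mu> \<nu> s \<le> bracket_excess \<kappa> \<mu> \<nu> r) \<and>
     (\<forall>s>r. s < length \<kappa> \<longrightarrow> bracket_excess \<kappa> \<mu> \<nu> s < bracket_excess \<kappa> \<mu> \<nu> r)"

lemma bracket_excess_Suc:
  "Suc s < length \<kappa> \<Longrightarrow> bracket_excess \<kappa> \<mu> \<nu> s =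
     bracket_excess \<kappa> \<mu> \<nu> (Suc s) + (\<mu> ! s - \<kappa> ! s) - (\<nu> ! Suc s - \<mu> ! Suc s)"
  by (simp add: bracket_excess_def sum.atLeast_Suc_lessThan)

lemma bracket_excess_last:
  "Suc s = length \<kappa> \<Longrightarrow> bracket_excess \<kappa> \<mu> \<nu> s = \<mu> ! s - \<kappa> ! s"
  by (simp add: bracket_excess_def sum.atLeast_Suc_lessThan)

lemma f_row_unique: "f_row \<kappa> \<mu> \<nu> r \<Longrightarrow> f_row \<kappa> \<mu> \<nu> r' \<Longrightarrow> r = r'"
  unfolding f_row_def by (metis linorder_neqE_nat not_less)

lemma f_row_exists:
  assumes "s < length \<kappa>" "0 < bracket_excess \<kappa> \<mu> \<nu> s"
  shows "\<exists>r. f_row \<kappa> \<mu> \<nu> r"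
proof -
  let ?W = "bracket_excess \<kappa> \<mu> \<nu>"
  define M where "M = Max (?W ` {..<length \<kappa>})"
  have le: "?W t \<le> M" if "t < length \<kappa>" for t using that by (auto simp: M_def)
  have "M \<in> ?W ` {..<length \<kappa>}" unfolding M_def using assms by (intro Max_in) auto
  then obtain t where t: "t < length \<kappa>" "?W t = M" by auto
  define r where "r = Max {t. t < length \<kappa> \<and> ?W t = M}"
  have "r \<in> {t. t < length \<kappa> \<and> ?W t = M}" unfolding r_def using t by (intro Max_in) auto
  moreover have "t \<le> r" if "t < length \<kappa>" "?W t = M" for t
    unfolding r_def using that by (intro Max_ge) auto
  ultimately show ?thesis
    unfolding f_row_def using le assms
    by (intro exI[of _ r]) (smt (verit) mem_Collect_eq not_le order.strict_trans)
qed

section \<open>Transport of the lowering row through two adjacent squares\<close>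

locale two_squares =
  fixes \<kappa>0 \<kappa>1 \<kappa>2 l0 l1 l2 :: "int list"
  assumes k01: "interlace \<kappa>0 \<kappa>1" and k12: "interlace \<kappa>1 \<kappa>2"
    and left: "interlace \<kappa>0 l0"
    and rule1: "local_rule \<kappa>0 \<kappa>1 l0 l1" and rule2: "local_rule \<kappa>1 \<kappa>2 l1 l2"
begin

text \<open>The function \<open>V\<close> interpolates between the two bracket excesses: \<open>W\<close> below and \<open>W'\<close> above
  differ from it by the carries of the two squares.\<close>

lemma interpolation:
  obtains D1 D2 V where
    "D1 0 = 0" "D1 (length \<kappa>0) = 0" "\<And>j. 0 \<le> D1 j"
    "\<And>j. j < length \<kappa>0 \<Longrightarrow> \<kappa>1 ! j + l0 ! j + D1 (Suc j) = l1 ! j + \<kappa>0 ! j + D1 j"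
    "\<And>j. Suc j < length \<kappa>0 \<Longrightarrow> l1 ! Suc j \<le> \<kappa>0 ! j"
    "\<And>j. Suc j < length \<kappa>0 \<Longrightarrow> D1 (Suc j) = 0 \<or> l1 ! Suc j = \<kappa>0 ! j"
    "D2 0 = 0" "D2 (length \<kappa>0) = 0" "\<And>j. 0 \<le> D2 j"
    "\<And>j. j < length \<kappa>0 \<Longrightarrow> \<kappa>2 ! j + l1 ! j + D2 (Suc j) = l2 ! j + \<kappa>1 ! j + D2 j"
    "\<And>j. Suc j < length \<kappa>0 \<Longrightarrow> l2 ! Suc j \<le> \<kappa>1 ! j"
    "\<And>j. Suc j < length \<kappa>0 \<Longrightarrow> D2 (Suc j) = 0 \<or> l2 ! Suc j = \<kappa>1 ! j"
    "\<And>s. s < length \<kappa>0 \<Longrightarrow> bracket_excess \<kappa>0 \<kappa>1 \<kappa>2 s = V s - (D2 (Suc s) :: int)"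
    "\<And>s. s < length \<kappa>0 \<Longrightarrow> bracket_excess l0 l1 l2 s = V s - (D1 s :: int)"
    "\<And>s. Suc s < length \<kappa>0 \<Longrightarrow> V s - V (Suc s) = (\<kappa>1 ! s - l2 ! Suc s) - (\<kappa>0 ! s - l1 ! Suc s)"
proof -
  let ?n = "length \<kappa>0"
  have len: "length \<kappa>1 = ?n" "length l0 = ?n" using k01 left by (auto simp: interlace_def)
  obtain D1 where D1: "D1 0 = 0" "D1 ?n = 0" "\<And>j. 0 \<le> D1 j"
    "\<And>j. j < ?n \<Longrightarrow> \<kappa>1 ! j + l0 ! j + D1 (Suc j) = l1 ! j + \<kappa>0 ! j + D1 j"
    "\<And>j. Suc j < ?n \<Longrightarrow> l1 ! Suc j \<le> \<kappa>0 ! j \<and> (D1 (Suc j) = 0 \<or> l1 ! Suc j = \<kappa>0 ! j)"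
    using rule1 unfolding local_rule_def by blast
  obtain D2 where D2: "D2 0 = 0" "D2 ?n = 0" "\<And>j. 0 \<le> D2 j"
    "\<And>j. j < ?n \<Longrightarrow> \<kappa>2 ! j + l1 ! j + D2 (Suc j) = l2 ! j + \<kappa>1 ! j + D2 j"
    "\<And>j. Suc j < ?n \<Longrightarrow> l2 ! Suc j \<le> \<kappa>1 ! j \<and> (D2 (Suc j) = 0 \<or> l2 ! Suc j = \<kappa>1 ! j)"
    using rule2 unfolding local_rule_def len by blast
  \<comment> \<open>The formula for the lower excess holds by definition. The one for the upper
    excess follows by induction from the bottom row, using the first square in row \<open>s\<close>
    and the second in row \<open>Suc s\<close>.\<close>
  define V where "V s = bracket_excess \<kappa>0 \<kappa>1 \<kappa>2 s + D2 (Suc s)" for s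
  have W': "bracket_excess l0 l1 l2 s = V s - D1 s" if "s < ?n" for s
  proof -
    have "s \<le> ?n - 1" using that by simp
    then show ?thesis
      using that
    proof (induction rule: inc_induct)
      case base
      then have "Suc (?n - 1) = ?n" by simp
      then show ?case
        using D1(2) D2(2) D1(4)[of "?n - 1"] len by (simp add: V_def bracket_excess_last)
    next
      case (step s)
      then have "Suc s < ?n" by simp
      then show ?case
        using step D1(4)[of s] D2(4)[of "Suc s"] len
        by (simp add: V_def bracket_excess_Suc)
    qed
  qed
  have "V s - V (Suc s) = (\<kappa>1 ! s - l2 ! Suc s) - (\<kappa>0 ! s - l1 ! Suc s)" if "Suc s < ?n" for s
    using that D2(4)[of "Suc s"] by (simp add: V_def bracket_excess_Suc)
  then show thesis using that[of D1 D2 V] D1 D2 W' by (auto simp: V_def)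
qed

text \<open>Carries are nonnegative, so \<open>V\<close> is positive at \<open>r'\<close>. Going
  down from there, either the second carry vanishes and the lower excess equals \<open>V\<close>, or
  \<open>V\<close> does not decrease; no carry enters the bottom row, so the search
  succeeds.\<close>

lemma f_row_defined_backward:
  assumes "f_row l0 l1 l2 r'"
  shows "\<exists>r. f_row \<kappa>0 \<kappa>1 \<kappa>2 r"
proof -
  let ?n = "length \<kappa>0"
  have len: "length l0 = ?n" using left by (simp add: interlace_def)
  obtain D1 D2 V where D1: "\<And>j. 0 \<le> (D1 j :: int)"
    and D2: "D2 ?n = (0 :: int)" "\<And>j. Suc j < ?n \<Longrightarrow> D2 (Suc j) = 0 \<or> l2 ! Suc j = \<kappa>1 ! j"
    and l1: "\<And>j. Suc j < ?n \<Longrightarrow> l1 ! Suc j \<le> \<kappa>0 ! j"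
    and W: "\<And>s. s < ?n \<Longrightarrow> bracket_excess \<kappa>0 \<kappa>1 \<kappa>2 s = V s - D2 (Suc s)"
    "\<And>s. s < ?n \<Longrightarrow> bracket_excess l0 l1 l2 s = V s - D1 s"
    and V: "\<And>s. Suc s < ?n \<Longrightarrow> V s - V (Suc s) = (\<kappa>1 ! s - l2 ! Suc s) - (\<kappa>0 ! s - l1 ! Suc s)"
    by (rule interpolation) blast
  have r': "r' < ?n" "0 < V r'"
    using assms W(2)[of r'] D1[of r'] len by (auto simp: f_row_def)
  have "\<exists>s<?n. 0 < bracket_excess \<kappa>0 \<kappa>1 \<kappa>2 s" if "s \<le> ?n - 1" "0 < V s" for s
    using that
  proof (induction rule: inc_induct)
    case base
    then have "bracket_excess \<kappa>0 \<kappa>1 \<kappa>2 (?n - 1) = V (?n - 1)"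
      using W(1)[of "?n - 1"] D2(1) r' by (cases ?n) auto
    then show ?case using base r' by (metis diff_less less_nat_zero_code not_gr_zero zero_less_one)
  next
    case (step s)
    show ?case
    proof (cases "D2 (Suc s) = 0")
      case True
      moreover have "s < ?n" using step by simp
      ultimately show ?thesis using step W(1)[of s] by auto
    next
      case False
      moreover have "Suc s < ?n" using step by simp
      ultimately have "V s \<le> V (Suc s)" using D2(2)[of s] V[of s] l1[of s] by auto
      then show ?thesis using step by simp
    qed
  qed
  then show ?thesis using r' f_row_exists[of _ \<kappa>0] by (metis Suc_diff_1 less_Suc_eq_le less_nat_zero_code linorder_neqE_nat)
qed

text \<open>\<open>V\<close> has the same maximum as the lower excess, with \<open>r\<close> the
  bottommost row attaining it. The upper excess is \<open>V - D1\<close>, so its row is found by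
  climbing from \<open>r\<close> as long as the first carry is positive. Between the two rows the
  first square then carries one unit less and the second one unit more.\<close>

lemma f_row_forward:
  assumes r: "f_row \<kappa>0 \<kappa>1 \<kappa>2 r"
  shows "\<exists>r'. f_row l0 l1 l2 r' \<and>
           local_rule \<kappa>0 (\<kappa>1[r := \<kappa>1 ! r - 1]) l0 (l1[r' := l1 ! r' - 1]) \<and>
           local_rule (\<kappa>1[r := \<kappa>1 ! r - 1]) \<kappa>2 (l1[r' := l1 ! r' - 1]) l2"
proof -
  let ?n = "length \<kappa>0"
  have len: "length \<kappa>1 = ?n" "length l0 = ?n" "length l1 = ?n" "length \<kappa>2 = ?n" "length l2 = ?n"
    using rule1 rule2 by (auto simp: local_rule_def)
  obtain D1 D2 V where D1: "D1 0 = (0::int)" "D1 ?n = 0" "\<And>j. 0 \<le> D1 j"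
    "\<And>j. j < ?n \<Longrightarrow> \<kappa>1 ! j + l0 ! j + D1 (Suc j) = l1 ! j + \<kappa>0 ! j + D1 j"
    "\<And>j. Suc j < ?n \<Longrightarrow> l1 ! Suc j \<le> \<kappa>0 ! j"
    "\<And>j. Suc j < ?n \<Longrightarrow> D1 (Suc j) = 0 \<or> l1 ! Suc j = \<kappa>0 ! j"
    and D2: "D2 0 = (0::int)" "D2 ?n = 0" "\<And>j. 0 \<le> D2 j"
    "\<And>j. j < ?n \<Longrightarrow> \<kappa>2 ! j + l1 ! j + D2 (Suc j) = l2 ! j + \<kappa>1 ! j + D2 j"
    "\<And>j. Suc j < ?n \<Longrightarrow> l2 ! Suc j \<le> \<kappa>1 ! j"
    "\<And>j. Suc j < ?n \<Longrightarrow> D2 (Suc j) = 0 \<or> l2 ! Suc j = \<kappa>1 ! j"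
    and W: "\<And>s. s < ?n \<Longrightarrow> bracket_excess \<kappa>0 \<kappa>1 \<kappa>2 s = V s - D2 (Suc s)"
    and W': "\<And>s. s < ?n \<Longrightarrow> bracket_excess l0 l1 l2 s = V s - D1 s"
    and V: "\<And>s. Suc s < ?n \<Longrightarrow> V s - V (Suc s) = (\<kappa>1 ! s - l2 ! Suc s) - (\<kappa>0 ! s - l1 ! Suc s)"
    by (rule interpolation) blast
  \<comment> \<open>A positive carry closes one of the two gaps in the difference formula for
    \<open>V\<close>, and the other gap has a fixed sign. So \<open>V\<close> does not decrease
    upwards across a positive \<open>D1\<close>, nor downwards across a positive
    \<open>D2\<close>.\<close>
  have V_up: "V (Suc s) \<le> V s" if "0 < D1 (Suc s)" "Suc s < ?n" for s
    using V[of s] D1(6)[of s] D2(5)[of s] that by auto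
  have V_down: "V s \<le> V (Suc s)" if "0 < D2 (Suc s)" "Suc s < ?n" for s
    using V[of s] D2(6)[of s] D1(5)[of s] that by auto
  have rn: "r < ?n" using r by (simp add: f_row_def)
  define M where "M = bracket_excess \<kappa>0 \<kappa>1 \<kappa>2 r"
  have M0: "0 < M" and M1: "\<And>s. s < ?n \<Longrightarrow> bracket_excess \<kappa>0 \<kappa>1 \<kappa>2 s \<le> M"
    and M2: "\<And>s. s < ?n \<Longrightarrow> r < s \<Longrightarrow> bracket_excess \<kappa>0 \<kappa>1 \<kappa>2 s < M"
    using r unfolding f_row_def M_def by (auto, metis linorder_neqE_nat order.refl order.strict_implies_order)
  have VM: "V s \<le> M \<and> (r < s \<longrightarrow> V s < M)" if "s < ?n" for s
  proof -
    have "s \<le> ?n - 1" using that by simp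
    then show ?thesis
    proof (induction rule: inc_induct)
      case base
      show ?case using W[of "?n - 1"] M1[of "?n - 1"] M2[of "?n - 1"] D2(2) that by (cases ?n) auto
    next
      case (step s)
      then have "Suc s < ?n" by simp
      then show ?case
        using step W[of s] M1[of s] M2[of s] D2(3)[of "Suc s"] V_down[of s]
        by (cases "D2 (Suc s) = 0") auto
    qed
  qed
  \<comment> \<open>\<open>M = V r - D2 (Suc r)\<close>, \<open>V r \<le> M\<close> and a
    nonnegative carry leave no slack.\<close>
  have Vr: "V r = M" and D2r: "D2 (Suc r) = 0"
    using VM[OF rn] W[OF rn] D2(3)[of "Suc r"] by (auto simp: M_def)
  have W'M: "bracket_excess l0 l1 l2 s \<le> M \<and> (r < s \<longrightarrow> bracket_excess l0 l1 l2 s < M)"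
    if "s < ?n" for s
    using W'[OF that] VM[OF that] D1(3)[of s] by auto
  \<comment> \<open>The climb ends at the top row at the latest, where \<open>D1 0 = 0\<close>, and
    \<open>V_up\<close> keeps \<open>V\<close> at its maximum on the way.\<close>
  have "\<exists>s\<le>r. D1 s = 0 \<and> V s = M \<and> (\<forall>t. s < t \<and> t \<le> r \<longrightarrow> 0 < D1 t \<and> V t = M)"
    if "t \<le> r" "V t = M" "\<forall>u. t < u \<and> u \<le> r \<longrightarrow> 0 < D1 u \<and> V u = M" for t
    using that
  proof (induction t)
    case 0
    then show ?case using D1(1) by auto
  next
    case (Suc t)
    show ?case
    proof (cases "D1 (Suc t) = 0")
      case True
      then show ?thesis using Suc by blast
    next
      case False
      then have "0 < D1 (Suc t)" using D1(3)[of "Suc t"] by simp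
      moreover have "V t = M" using V_up[of t] VM[of t] calculation Suc rn by simp
      ultimately show ?thesis using Suc by (metis Suc_leD Suc_lessI)
    qed
  qed
  from this[of r] Vr obtain r' where r': "r' \<le> r" "D1 r' = 0" "V r' = M"
    and D1pos: "\<And>t. r' < t \<Longrightarrow> t \<le> r \<Longrightarrow> 0 < D1 t" and VM': "\<And>t. r' < t \<Longrightarrow> t \<le> r \<Longrightarrow> V t = M"
    by auto
  have r'n: "r' < ?n" using r' rn by simp
  have W'r': "bracket_excess l0 l1 l2 r' = M" using W'[OF r'n] r' by simp
  have "bracket_excess l0 l1 l2 s < M" if "s < ?n" "r' < s" for s
    using W'[of s] W'M[of s] D1pos[of s] VM[of s] that by (cases "s \<le> r") auto
  then have fr': "f_row l0 l1 l2 r'"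
    using W'r' W'M M0 r'n len by (simp add: f_row_def)
  \<comment> \<open>Lowering \<open>\<kappa>1\<close> in row \<open>r\<close> and \<open>l1\<close>
    in row \<open>r'\<close> unbalances the row equations only at these rows; one unit moved through
    the carries between them restores both squares. Positivity of \<open>D1\<close> on this range
    keeps \<open>E1\<close> nonnegative.\<close>
  define E1 where "E1 t = (if r' < t \<and> t \<le> r then D1 t - 1 else D1 t)" for t
  define E2 where "E2 t = (if r' < t \<and> t \<le> r then D2 t + 1 else D2 t)" for t
  \<comment> \<open>\<open>V\<close> is constant on this range and the positive first carry closes
    the gap of its square, so the other gap closes as well. This is the complementarity that the
    increased carry \<open>E2\<close> needs.\<close>
  have l2k1: "l2 ! Suc j = \<kappa>1 ! j" if "r' < Suc j" "Suc j \<le> r" for j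
  proof -
    have "V j = M" using VM'[of j] r' that by (cases "j = r'") auto
    then show ?thesis using V[of j] VM'[of "Suc j"] D1(6)[of j] D1pos[of "Suc j"] that rn by auto
  qed
  \<comment> \<open>The strict drop of \<open>V\<close> after row \<open>r\<close> leaves room for
    lowering \<open>\<kappa>1 ! r\<close>.\<close>
  have gap: "l2 ! Suc r < \<kappa>1 ! r" if "Suc r < ?n"
    using V[of r] VM[of "Suc r"] Vr D1(5)[of r] that by auto
  have "local_rule \<kappa>0 (\<kappa>1[r := \<kappa>1 ! r - 1]) l0 (l1[r' := l1 ! r' - 1])"
    unfolding local_rule_def
  proof (intro conjI exI[of _ E1] allI impI)
    fix j
    show "0 \<le> E1 j" using D1(3)[of j] D1pos[of j] by (auto simp: E1_def)
  next
    fix j assume j: "j < ?n"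
    then show "\<kappa>1[r := \<kappa>1 ! r - 1] ! j + l0 ! j + E1 (Suc j) = l1[r' := l1 ! r' - 1] ! j + \<kappa>0 ! j + E1 j"
      using D1(4)[OF j] r'(1) len
      by (cases "j = r"; cases "j = r'"; cases "j < r'"; cases "j < r") (auto simp: E1_def)
  next
    fix j assume j: "Suc j < ?n"
    then show "l1[r' := l1 ! r' - 1] ! Suc j \<le> \<kappa>0 ! j"
      using D1(5)[OF j] len by (cases "r' = Suc j") auto
    show "E1 (Suc j) = 0 \<or> l1[r' := l1 ! r' - 1] ! Suc j = \<kappa>0 ! j"
      using D1(6)[OF j] D1pos[of "Suc j"] len j r' by (cases "r' = Suc j") (auto simp: E1_def)
  qed (use D1 rn len in \<open>auto simp: E1_def\<close>)
  moreover have "local_rule (\<kappa>1[r := \<kappa>1 ! r - 1]) \<kappa>2 (l1[r' := l1 ! r' - 1]) l2"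
    unfolding local_rule_def
  proof (intro conjI exI[of _ E2] allI impI)
    fix j
    show "0 \<le> E2 j" using D2(3)[of j] by (auto simp: E2_def)
  next
    fix j assume "j < length (\<kappa>1[r := \<kappa>1 ! r - 1])"
    then have j: "j < ?n" using len by simp
    then show "\<kappa>2 ! j + l1[r' := l1 ! r' - 1] ! j + E2 (Suc j) = l2 ! j + \<kappa>1[r := \<kappa>1 ! r - 1] ! j + E2 j"
      using D2(4)[OF j] r'(1) len
      by (cases "j = r"; cases "j = r'"; cases "j < r'"; cases "j < r") (auto simp: E2_def)
  next
    fix j assume "Suc j < length (\<kappa>1[r := \<kappa>1 ! r - 1])"
    then have j: "Suc j < ?n" using len by simp
    then show "l2 ! Suc j \<le> \<kappa>1[r := \<kappa>1 ! r - 1] ! j"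
      using D2(5)[OF j] len gap by (cases "r = j") auto
    show "E2 (Suc j) = 0 \<or> l2 ! Suc j = \<kappa>1[r := \<kappa>1 ! r - 1] ! j"
      using D2(6)[OF j] l2k1[of j] D2r len j r' by (cases "r = j") (auto simp: E2_def)
  qed (use D2 rn len in \<open>auto simp: E2_def\<close>)
  ultimately show ?thesis using fr' by blast
qed

end

text \<open>The first surviving opening bracket follows the last maximum of the prefix excess, so
  ties go to the topmost row. For interlacing signatures, the strict increase from row
  \<open>r - 1\<close> shows that row \<open>r\<close> has an opening bracket; the top row has no
  predecessor and needs its own condition.\<close>

definition e_row :: "int list \<Rightarrow> int list \<Rightarrow> int list \<Rightarrow> nat \<Rightarrow> bool" where
  "e_row \<kappa> \<mu> \<nu> r \<longleftrightarrow> r < length \<kappa> \<and> (r = 0 \<longrightarrow> \<mu> ! 0 < \<nu> ! 0) \<and>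
     (\<forall>s<r. bracket_excess \<kappa> \<mu> \<nu> s < bracket_excess \<kappa> \<mu> \<nu> r) \<and>
     (\<forall>s>r. s < length \<kappa> \<longrightarrow> bracket_excess \<kappa> \<mu> \<nu> s \<le> bracket_excess \<kappa> \<mu> \<nu> r)"

text \<open>For \<open>d = -1\<close> a closing bracket of row \<open>r\<close> becomes an opening
  one: this costs one at row \<open>r\<close>, where only closing brackets count, and two at each
  row above. The shift turns the weak and strict inequalities of \<open>f_row\<close> into those of
  \<open>e_row\<close>, and \<open>d = 1\<close> reverses it.\<close>

lemma bracket_excess_update:
  assumes "length \<mu> = length \<kappa>" "r < length \<kappa>" "s < length \<kappa>"
  shows "bracket_excess \<kappa> (\<mu>[r := \<mu> ! r + d]) \<nu> s =
    bracket_excess \<kappa> \<mu> \<nu> s + (if s \<le> r then d else 0) + (if s < r then d else 0)"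
proof -
  have upd: "\<mu>[r := \<mu> ! r + d] ! t = \<mu> ! t + (if t = r then d else 0)" if "t < length \<kappa>" for t
    using that assms by simp
  have "(\<Sum>t=s..<length \<kappa>. \<mu>[r := \<mu> ! r + d] ! t - \<kappa> ! t) =
      (\<Sum>t=s..<length \<kappa>. (\<mu> ! t - \<kappa> ! t) + (if t = r then d else 0))"
    by (rule sum.cong) (auto simp: upd simp del: nth_list_update)
  also have "\<dots> = (\<Sum>t=s..<length \<kappa>. \<mu> ! t - \<kappa> ! t) + (if s \<le> r then d else 0)"
    using assms by (subst sum.distrib) simp
  finally have 1: "(\<Sum>t=s..<length \<kappa>. \<mu>[r := \<mu> ! r + d] ! t - \<kappa> ! t) = \<dots>" .
  have "(\<Sum>t=Suc s..<length \<kappa>. \<nu> ! t - \<mu>[r := \<mu> ! r + d] ! t) =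
      (\<Sum>t=Suc s..<length \<kappa>. (\<nu> ! t - \<mu> ! t) + (if t = r then - d else 0))"
    by (rule sum.cong) (auto simp: upd simp del: nth_list_update)
  also have "\<dots> = (\<Sum>t=Suc s..<length \<kappa>. \<nu> ! t - \<mu> ! t) + (if s < r then - d else 0)"
    using assms by (subst sum.distrib) (simp add: Suc_le_eq)
  finally have 2: "(\<Sum>t=Suc s..<length \<kappa>. \<nu> ! t - \<mu>[r := \<mu> ! r + d] ! t) = \<dots>" .
  show ?thesis unfolding bracket_excess_def 1 2 by simp
qed

lemma interlace_update_upper:
  assumes "interlace \<kappa> \<mu>" "\<kappa> ! r \<le> v" "0 < r \<Longrightarrow> v \<le> \<kappa> ! (r - 1)"
  shows "interlace \<kappa> (\<mu>[r := v])"
proof (cases "r < length \<mu>")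
  case True
  then show ?thesis using assms unfolding interlace_def
    by (intro conjI allI impI) (auto simp: nth_list_update)
qed (use assms in \<open>simp add: not_less list_update_beyond\<close>)

lemma interlace_update_lower:
  assumes "interlace \<mu> \<nu>" "v \<le> \<nu> ! r" "Suc r < length \<mu> \<Longrightarrow> \<nu> ! Suc r \<le> v"
  shows "interlace (\<mu>[r := v]) \<nu>"
proof (cases "r < length \<mu>")
  case True
  then show ?thesis using assms unfolding interlace_def
    by (intro conjI allI impI) (auto simp: nth_list_update)
qed (use assms in \<open>simp add: not_less list_update_beyond\<close>)

text \<open>The excess drops strictly from row \<open>r\<close> to row \<open>Suc r\<close>, and
  each of the two interlacing bounds on \<open>\<mu> ! Suc r\<close> turns this drop into one of the
  gaps. In the last row, positivity of the excess gives the first gap.\<close>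

lemma f_row_gap:
  assumes "interlace \<kappa> \<mu>" "interlace \<mu> \<nu>" "f_row \<kappa> \<mu> \<nu> r"
  shows "\<kappa> ! r < \<mu> ! r" "Suc r < length \<kappa> \<Longrightarrow> \<nu> ! Suc r < \<mu> ! r"
proof -
  have r: "r < length \<kappa>" "0 < bracket_excess \<kappa> \<mu> \<nu> r" using assms(3) by (auto simp: f_row_def)
  have "\<kappa> ! r < \<mu> ! r \<and> (Suc r < length \<kappa> \<longrightarrow> \<nu> ! Suc r < \<mu> ! r)"
  proof (cases "Suc r < length \<kappa>")
    case True
    then have "bracket_excess \<kappa> \<mu> \<nu> (Suc r) < bracket_excess \<kappa> \<mu> \<nu> r"
      using assms(3) by (simp add: f_row_def)
    moreover have "\<mu> ! Suc r \<le> \<nu> ! Suc r" "\<mu> ! Suc r \<le> \<kappa> ! r"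
      using assms(1,2) True by (auto simp: interlace_def)
    ultimately show ?thesis using bracket_excess_Suc[OF True, of \<mu> \<nu>] by auto
  next
    case False
    then show ?thesis using r bracket_excess_last[of r \<kappa> \<mu> \<nu>] by simp
  qed
  then show "\<kappa> ! r < \<mu> ! r" "Suc r < length \<kappa> \<Longrightarrow> \<nu> ! Suc r < \<mu> ! r" by auto
qed

lemma e_row_gap:
  assumes "interlace \<kappa> \<mu>" "interlace \<mu> \<nu>" "e_row \<kappa> \<mu> \<nu> r"
  shows "\<mu> ! r < \<nu> ! r" "0 < r \<Longrightarrow> \<mu> ! r < \<kappa> ! (r - 1)"
proof -
  have r: "r < length \<kappa>" using assms(3) by (auto simp: e_row_def)
  have "\<mu> ! r < \<nu> ! r \<and> (0 < r \<longrightarrow> \<mu> ! r < \<kappa> ! (r - 1))"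
  proof (cases r)
    case 0
    then show ?thesis using assms(3) by (simp add: e_row_def)
  next
    case (Suc s)
    then have "bracket_excess \<kappa> \<mu> \<nu> s < bracket_excess \<kappa> \<mu> \<nu> (Suc s)"
      using assms(3) by (simp add: e_row_def)
    moreover have s: "Suc s < length \<kappa>" using r Suc by simp
    then have "\<kappa> ! s \<le> \<mu> ! s" "\<nu> ! Suc s \<le> \<mu> ! s"
      using assms(1,2) by (simp_all add: interlace_def)
    ultimately show ?thesis using bracket_excess_Suc[OF s, of \<mu> \<nu>] Suc by simp
  qed
  then show "\<mu> ! r < \<nu> ! r" "0 < r \<Longrightarrow> \<mu> ! r < \<kappa> ! (r - 1)" by auto
qed

lemma f_row_interlace:
  assumes "interlace \<kappa> \<mu>" "interlace \<mu> \<nu>" "f_row \<kappa> \<mu> \<nu> r"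
  shows "interlace \<kappa> (\<mu>[r := \<mu> ! r - 1])" "interlace (\<mu>[r := \<mu> ! r - 1]) \<nu>"
proof -
  note gap = f_row_gap[OF assms]
  have r: "r < length \<kappa>" "length \<mu> = length \<kappa>" using assms by (auto simp: f_row_def interlace_def)
  have "\<mu> ! r \<le> \<kappa> ! (r - 1)" if "0 < r" using assms(1) r that by (cases r) (auto simp: interlace_def)
  then show "interlace \<kappa> (\<mu>[r := \<mu> ! r - 1])"
    using assms(1) gap(1) by (intro interlace_update_upper) auto
  have "\<mu> ! r \<le> \<nu> ! r" using assms(2) r by (auto simp: interlace_def)
  then show "interlace (\<mu>[r := \<mu> ! r - 1]) \<nu>"
    using assms(2) gap(2) r by (intro interlace_update_lower) auto
qed

lemma e_row_interlace:
  assumes "interlace \<kappa> \<mu>" "interlace \<mu> \<nu>" "e_row \<kappa> \<mu> \<nu> r"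
  shows "interlace \<kappa> (\<mu>[r := \<mu> ! r + 1])" "interlace (\<mu>[r := \<mu> ! r + 1]) \<nu>"
proof -
  note gap = e_row_gap[OF assms]
  have r: "r < length \<kappa>" "length \<mu> = length \<kappa>" using assms by (auto simp: e_row_def interlace_def)
  have "\<kappa> ! r \<le> \<mu> ! r" using assms(1) r by (auto simp: interlace_def)
  then show "interlace \<kappa> (\<mu>[r := \<mu> ! r + 1])"
    using assms(1) gap(2) by (intro interlace_update_upper) auto
  have "\<nu> ! Suc r \<le> \<mu> ! r" if "Suc r < length \<mu>" using assms(2) that by (auto simp: interlace_def)
  then show "interlace (\<mu>[r := \<mu> ! r + 1]) \<nu>"
    using assms(2) gap(1) by (intro interlace_update_lower) auto
qed

lemma f_row_imp_e_row:
  assumes "interlace \<kappa> \<mu>" "interlace \<mu> \<nu>" "f_row \<kappa> \<mu> \<nu> r"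
  shows "e_row \<kappa> (\<mu>[r := \<mu> ! r - 1]) \<nu> r"
proof -
  have len: "length \<mu> = length \<kappa>" and r: "r < length \<kappa>"
    using assms by (auto simp: interlace_def f_row_def)
  have upd: "bracket_excess \<kappa> (\<mu>[r := \<mu> ! r - 1]) \<nu> s =
    bracket_excess \<kappa> \<mu> \<nu> s + (if s \<le> r then -1 else 0) + (if s < r then -1 else 0)"
    if "s < length \<kappa>" for s using bracket_excess_update[OF len r that, of "-1"] by simp
  show ?thesis
    unfolding e_row_def
  proof (intro conjI allI impI)
    assume "r = 0"
    moreover have "\<mu> ! r \<le> \<nu> ! r" using assms(2) r len by (simp add: interlace_def)
    ultimately show "\<mu>[r := \<mu> ! r - 1] ! 0 < \<nu> ! 0" using r len by simp
  next
    fix s assume s: "s < r"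
    then have "bracket_excess \<kappa> \<mu> \<nu> s \<le> bracket_excess \<kappa> \<mu> \<nu> r" using assms(3) by (simp add: f_row_def)
    then show "bracket_excess \<kappa> (\<mu>[r := \<mu> ! r - 1]) \<nu> s < bracket_excess \<kappa> (\<mu>[r := \<mu> ! r - 1]) \<nu> r"
      using upd[of s] upd[of r] s r by simp
  next
    fix s assume s: "r < s" "s < length \<kappa>"
    then have "bracket_excess \<kappa> \<mu> \<nu> s < bracket_excess \<kappa> \<mu> \<nu> r" using assms(3) by (simp add: f_row_def)
    then show "bracket_excess \<kappa> (\<mu>[r := \<mu> ! r - 1]) \<nu> s \<le> bracket_excess \<kappa> (\<mu>[r := \<mu> ! r - 1]) \<nu> r"
      using upd[of s] upd[of r] s r by simp
  qed (rule r)
qed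

lemma e_row_imp_f_row:
  assumes "interlace \<kappa> \<mu>" "interlace \<mu> \<nu>" "e_row \<kappa> \<mu> \<nu> r"
  shows "f_row \<kappa> (\<mu>[r := \<mu> ! r + 1]) \<nu> r"
proof -
  have len: "length \<mu> = length \<kappa>" and r: "r < length \<kappa>"
    using assms by (auto simp: interlace_def e_row_def)
  have upd: "bracket_excess \<kappa> (\<mu>[r := \<mu> ! r + 1]) \<nu> s =
    bracket_excess \<kappa> \<mu> \<nu> s + (if s \<le> r then 1 else 0) + (if s < r then 1 else 0)"
    if "s < length \<kappa>" for s using bracket_excess_update[OF len r that, of 1] by simp
  \<comment> \<open>\<open>f_row\<close> demands a positive maximum. The excess of the bottom row is
    never negative, so the maximum is at least 0 before raising and at least 1 afterwards.\<close>
  let ?m = "length \<kappa> - 1"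
  have m: "Suc ?m = length \<kappa>" using r by simp
  have "\<kappa> ! ?m \<le> \<mu> ! ?m" using assms(1) r by (simp add: interlace_def)
  then have "0 \<le> bracket_excess \<kappa> \<mu> \<nu> ?m" using bracket_excess_last[OF m] by simp
  also have "\<dots> \<le> bracket_excess \<kappa> \<mu> \<nu> r"
  proof (cases "r = ?m")
    case False
    then have "r < ?m" using r by simp
    then show ?thesis using assms(3) m unfolding e_row_def by simp
  qed simp
  finally have nonneg: "0 \<le> bracket_excess \<kappa> \<mu> \<nu> r" .
  show ?thesis
    unfolding f_row_def
  proof (intro conjI allI impI)
    show "0 < bracket_excess \<kappa> (\<mu>[r := \<mu> ! r + 1]) \<nu> r" using upd[of r] r nonneg by simp
  next
    fix s assume s: "s < r"
    then have "bracket_excess \<kappa> \<mu> \<nu> s < bracket_excess \<kappa> \<mu> \<nu> r" using assms(3) by (simp add: e_row_def)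
    then show "bracket_excess \<kappa> (\<mu>[r := \<mu> ! r + 1]) \<nu> s \<le> bracket_excess \<kappa> (\<mu>[r := \<mu> ! r + 1]) \<nu> r"
      using upd[of s] upd[of r] s r by simp
  next
    fix s assume s: "r < s" "s < length \<kappa>"
    then have "bracket_excess \<kappa> \<mu> \<nu> s \<le> bracket_excess \<kappa> \<mu> \<nu> r" using assms(3) by (simp add: e_row_def)
    then show "bracket_excess \<kappa> (\<mu>[r := \<mu> ! r + 1]) \<nu> s < bracket_excess \<kappa> (\<mu>[r := \<mu> ! r + 1]) \<nu> r"
      using upd[of s] upd[of r] s r by simp
  qed (rule r)
qed

section \<open>Bracket reduction row by row\<close>

text \<open>This is the step of the fold in \<open>remaining_brackets\<close>, with predicates in
  place of labels so that cancellation can be studied without tableaux.\<close>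

definition reduce_step :: "('a \<Rightarrow> bool) \<Rightarrow> ('a \<Rightarrow> bool) \<Rightarrow> 'a \<Rightarrow> 'a list \<Rightarrow> 'a list" where
  "reduce_step opening closing c w = (if opening c \<and> w \<noteq> [] \<and> closing (hd w) then tl w else c # w)"

lemma reduce_step_cancel:
  "opening c \<Longrightarrow> closing d \<Longrightarrow> reduce_step opening closing c (d # w) = w"
  by (simp add: reduce_step_def)

lemma reduce_step_push:
  "opening c \<Longrightarrow> w \<noteq> [] \<Longrightarrow> \<not> closing (hd w) \<Longrightarrow> reduce_step opening closing c w = c # w"
  "\<not> opening c \<Longrightarrow> reduce_step opening closing c w = c # w"
  "reduce_step opening closing c [] = [c]"
  by (simp_all add: reduce_step_def)

lemma foldr_reduce_step_closing:
  "\<forall>c\<in>set cs. \<not> opening c \<Longrightarrow> foldr (reduce_step opening closing) cs w = cs @ w"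
  by (induction cs) (auto simp: reduce_step_push(2))

text \<open>The rightmost bracket of \<open>os\<close> meets the reduced word first, so
  \<open>os\<close> cancels against the front of \<open>A\<close>. If \<open>A\<close> runs out, the
  leading brackets of \<open>os\<close> are left in front of \<open>B\<close>.\<close>

lemma foldr_reduce_step_opening:
  assumes "\<forall>c\<in>set os. opening c \<and> \<not> closing c" "\<forall>c\<in>set A. closing c" "\<forall>c\<in>set B. \<not> closing c"
  shows "foldr (reduce_step opening closing) os (A @ B) =
    drop (length os) A @ take (length os - length A) os @ B"
  using assms(1)
proof (induction os)
  case (Cons c os)
  then have IH: "foldr (reduce_step opening closing) os (A @ B) =
    drop (length os) A @ take (length os - length A) os @ B" by simp
  have c: "opening c" using Cons.prems by simp
  show ?case
  proof (cases "length os < length A")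
    case True
    then have "closing (A ! length os)" using assms(2) by simp
    moreover have "drop (length os) A = A ! length os # drop (Suc (length os)) A"
      using True by (rule Cons_nth_drop_Suc[symmetric])
    ultimately show ?thesis using IH True c by (simp add: reduce_step_cancel)
  next
    case False
    define w where "w = take (length os - length A) os @ B"
    have "\<not> closing d" if "d \<in> set w" for d
      using that assms(3) Cons.prems by (auto simp: w_def dest: in_set_takeD)
    then have "reduce_step opening closing c w = c # w"
      using c by (cases "w = []") (auto simp: reduce_step_push)
    then show ?thesis using IH False by (simp add: w_def Suc_diff_le)
  qed
qed simp

context
  fixes closes opens :: "nat \<Rightarrow> 'a list"
begin

text \<open>Together with \<open>rest_opens\<close> this is the reduced word of the rows
  \<open>0\<close> to \<open>s - 1\<close>. Row \<open>s\<close> is read before them: its opening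
  brackets cancel from the front, and its closing brackets are then put in front
  uncancelled.\<close>

primrec rest_closes :: "nat \<Rightarrow> 'a list" where
  "rest_closes 0 = []"
| "rest_closes (Suc s) = closes s @ drop (length (opens s)) (rest_closes s)"

primrec rest_opens :: "nat \<Rightarrow> 'a list" where
  "rest_opens 0 = []"
| "rest_opens (Suc s) = take (length (opens s) - length (rest_closes s)) (opens s) @ rest_opens s"

lemma set_rest_closes: "c \<in> set (rest_closes s) \<Longrightarrow> \<exists>t<s. c \<in> set (closes t)"
  by (induction s) (auto dest: in_set_dropD intro: less_SucI)

lemma set_rest_opens: "c \<in> set (rest_opens s) \<Longrightarrow> \<exists>t<s. c \<in> set (opens t)"
  by (induction s) (auto dest: in_set_takeD intro: less_SucI)

lemma foldr_reduce_rows: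
  assumes "\<And>t c. t < s \<Longrightarrow> c \<in> set (closes t) \<Longrightarrow> closing c \<and> \<not> opening c"
    and "\<And>t c. t < s \<Longrightarrow> c \<in> set (opens t) \<Longrightarrow> opening c \<and> \<not> closing c"
  shows "foldr (reduce_step opening closing) (concat (map (\<lambda>t. closes t @ opens t) (rev [0..<s]))) []
    = rest_closes s @ rest_opens s"
  using assms
proof (induction s)
  case (Suc s)
  have "\<forall>c\<in>set (rest_closes s). closing c" "\<forall>c\<in>set (rest_opens s). \<not> closing c"
    using set_rest_closes[of _ s] set_rest_opens[of _ s] Suc.prems by (meson less_SucI)+
  moreover have "\<forall>c\<in>set (opens s). opening c \<and> \<not> closing c" "\<forall>c\<in>set (closes s). \<not> opening c"
    using Suc.prems by auto
  moreover have "foldr (reduce_step opening closing) (concat (map (\<lambda>t. closes t @ opens t) (rev [0..<s]))) []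
      = rest_closes s @ rest_opens s"
    using Suc.IH Suc.prems by (meson less_SucI)
  ultimately show ?case
    by (simp add: foldr_reduce_step_opening foldr_reduce_step_closing)
qed simp

section \<open>Surviving brackets located by the bracket excess\<close>

context
  fixes \<kappa> \<mu> \<nu> :: "int list"
  assumes \<kappa>\<mu>: "interlace \<kappa> \<mu>" and \<mu>\<nu>: "interlace \<mu> \<nu>"
    and closes_len: "\<And>s. s < length \<kappa> \<Longrightarrow> int (length (closes s)) = \<mu> ! s - \<kappa> ! s"
    and opens_len: "\<And>s. s < length \<kappa> \<Longrightarrow> int (length (opens s)) = \<nu> ! s - \<mu> ! s"
begin

abbreviation (input) "W \<equiv> bracket_excess \<kappa> \<mu> \<nu>"

text \<open>The common right-hand side is the maximum of \<open>W t\<close> over the rows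
  \<open>t < s\<close>, expressed as a bound that is attained. Comparing bracket counts at row
  \<open>s\<close> thereby becomes comparing excesses.\<close>

lemma rest_closes_excess:
  assumes "0 < s" "s < length \<kappa>"
  shows "(\<forall>t<s. W t \<le> int (length (rest_closes s)) - int (length (opens s)) + W s) \<and>
    (\<exists>t<s. W t = int (length (rest_closes s)) - int (length (opens s)) + W s)"
  using assms
proof (induction s)
  case (Suc s)
  \<comment> \<open>For \<open>s > 0\<close>, passing to \<open>Suc s\<close> replaces the maximum
    over \<open>t < s\<close> by its maximum with \<open>W s\<close>.\<close>
  have eq: "int (length (rest_closes (Suc s))) - int (length (opens (Suc s))) + W (Suc s) =
      W s + max 0 (int (length (rest_closes s)) - int (length (opens s)))"
    using Suc.prems closes_len[of s] opens_len[of "Suc s"]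
    by (simp add: bracket_excess_Suc of_nat_diff max_def)
  show ?case
  proof (cases "s = 0")
    case True
    then show ?thesis unfolding eq by auto
  next
    case False
    with Suc have IH: "\<forall>t<s. W t \<le> int (length (rest_closes s)) - int (length (opens s)) + W s"
      "\<exists>t<s. W t = int (length (rest_closes s)) - int (length (opens s)) + W s" by auto
    then obtain t where t: "t < s" "W t = int (length (rest_closes s)) - int (length (opens s)) + W s"
      by blast
    have "W u \<le> W s + max 0 (int (length (rest_closes s)) - int (length (opens s)))" if "u < Suc s" for u
      using IH(1) that by (cases "u = s") (auto simp: less_Suc_eq)
    moreover have "\<exists>u<Suc s. W u = W s + max 0 (int (length (rest_closes s)) - int (length (opens s)))"
    proof (cases "0 \<le> int (length (rest_closes s)) - int (length (opens s))")
      case True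
      then show ?thesis using t by (intro exI[of _ t]) simp
    next
      case False
      then show ?thesis by (intro exI[of _ s]) simp
    qed
    ultimately show ?thesis unfolding eq by blast
  qed
qed simp

lemma rest_closes_le_opens_iff:
  assumes "s < length \<kappa>"
  shows "length (rest_closes s) \<le> length (opens s) \<longleftrightarrow> (\<forall>t<s. W t \<le> W s)"
proof (cases "s = 0")
  case False
  then obtain t where "\<forall>t<s. W t \<le> int (length (rest_closes s)) - int (length (opens s)) + W s"
    "t < s" "W t = int (length (rest_closes s)) - int (length (opens s)) + W s"
    using rest_closes_excess[of s] assms by blast
  then show ?thesis by (smt (verit) of_nat_le_iff)
qed simp

lemma rest_closes_less_opens_iff:
  assumes "s < length \<kappa>"
  shows "length (rest_closes s) < length (opens s) \<longleftrightarrow> (\<forall>t<s. W t < W s) \<and> (s = 0 \<longrightarrow> \<mu> ! 0 < \<nu> ! 0)"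
proof (cases "s = 0")
  case True
  have "0 < length (opens s) \<longleftrightarrow> \<mu> ! s < \<nu> ! s" using opens_len[OF assms] by linarith
  with True show ?thesis by simp
next
  case False
  then obtain t where "\<forall>t<s. W t \<le> int (length (rest_closes s)) - int (length (opens s)) + W s"
    "t < s" "W t = int (length (rest_closes s)) - int (length (opens s)) + W s"
    using rest_closes_excess[of s] assms by blast
  with False show ?thesis by (smt (verit) of_nat_less_iff)
qed

text \<open>The opening brackets of row \<open>r\<close> cancel all closing brackets left by the
  rows above, so the survivors end in row \<open>r\<close>. Rows of larger index cancel from the
  front and never use up all survivors, so the last one stays.\<close>

lemma last_rest_closes:
  assumes "f_row \<kappa> \<mu> \<nu> r"
  shows "rest_closes (length \<kappa>) \<noteq> [] \<and> last (rest_closes (length \<kappa>)) = last (closes r)"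
proof -
  have r: "r < length \<kappa>" using assms by (simp add: f_row_def)
  have ne: "closes r \<noteq> []" using f_row_gap(1)[OF \<kappa>\<mu> \<mu>\<nu> assms] closes_len[OF r] by auto
  have "rest_closes s \<noteq> [] \<and> last (rest_closes s) = last (closes r)" if "Suc r \<le> s" "s \<le> length \<kappa>" for s
    using that
  proof (induction s rule: dec_induct)
    case base
    have "length (rest_closes r) \<le> length (opens r)"
      using rest_closes_le_opens_iff[OF r] assms by (simp add: f_row_def)
    then show ?case using ne by simp
  next
    case (step s)
    have "W s < W r" using assms step by (simp add: f_row_def)
    then have "\<not> length (rest_closes s) \<le> length (opens s)"
      using rest_closes_le_opens_iff[of s] step by (auto intro!: exI[of _ r])
    then show ?case using step by (simp add: last_drop)
  qed
  then show ?thesis using r by simp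
qed

text \<open>The excess of the bottom row counts its own closing brackets. If there are none, the
  survivors come from rows above, one of which must then have larger, hence positive,
  excess.\<close>

lemma rest_closes_nonempty:
  assumes "rest_closes (length \<kappa>) \<noteq> []"
  shows "\<exists>r. f_row \<kappa> \<mu> \<nu> r"
proof (cases "length \<kappa>")
  case 0
  then show ?thesis using assms by simp
next
  case (Suc s)
  then have "0 < length (closes s) + (length (rest_closes s) - length (opens s))"
    using assms by auto
  moreover have "W s = int (length (closes s))" using bracket_excess_last[of s \<kappa> \<mu> \<nu>] closes_len[of s] Suc by simp
  ultimately have "\<exists>t<length \<kappa>. 0 < W t"
  proof (cases "length (closes s) = 0")
    case True
    then have "\<not> length (rest_closes s) \<le> length (opens s)"
      using \<open>0 < _\<close> by simp
    then show ?thesis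
      using rest_closes_le_opens_iff[of s] Suc \<open>W s = _\<close> True by (metis lessI less_trans not_le of_nat_0)
  qed (use Suc in auto)
  then show ?thesis using f_row_exists by blast
qed

text \<open>Row \<open>r\<close> has more opening brackets than there are closing brackets to
  cancel, so its leading one survives; rows of larger index leave no opening bracket in front of
  it.\<close>

lemma hd_rest_opens:
  assumes "e_row \<kappa> \<mu> \<nu> r"
  shows "rest_opens (length \<kappa>) \<noteq> [] \<and> hd (rest_opens (length \<kappa>)) = hd (opens r)"
proof -
  have r: "r < length \<kappa>" using assms by (simp add: e_row_def)
  have "rest_opens s \<noteq> [] \<and> hd (rest_opens s) = hd (opens r)" if "Suc r \<le> s" "s \<le> length \<kappa>" for s
    using that
  proof (induction s rule: dec_induct)
    case base
    have "length (rest_closes r) < length (opens r)"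
      using rest_closes_less_opens_iff[OF r] assms by (simp add: e_row_def)
    then show ?case by (cases "opens r") auto
  next
    case (step s)
    have "W s \<le> W r" using assms step by (simp add: e_row_def)
    then have "\<not> length (rest_closes s) < length (opens s)"
      using rest_closes_less_opens_iff[of s] step by (auto simp: not_less intro!: exI[of _ r])
    then show ?case using step by simp
  qed
  then show ?thesis using r by simp
qed

lemma rest_opens_nonempty:
  assumes "rest_opens (length \<kappa>) \<noteq> []"
  shows "\<exists>r. e_row \<kappa> \<mu> \<nu> r"
proof -
  have *: "\<exists>t<s. length (rest_closes t) < length (opens t)" if "rest_opens s \<noteq> []" for s
    using that
  proof (induction s)
    case (Suc s)
    then show ?case by (cases "length (rest_closes s) < length (opens s)") (auto intro: less_SucI)
  qed simp
  \<comment> \<open>\<open>r\<close> will be the bottommost row that leaves an opening bracket. Each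
    row below it is dominated by some row above that one, and strong induction leads back to
    \<open>W r\<close>.\<close>
  define S where "S = {t. t < length \<kappa> \<and> length (rest_closes t) < length (opens t)}"
  define r where "r = Max S"
  have "S \<noteq> {}" "finite S" using *[OF assms] by (auto simp: S_def)
  then have rS: "r \<in> S" and max: "\<And>t. t \<in> S \<Longrightarrow> t \<le> r" unfolding r_def by auto
  then have r: "r < length \<kappa>" "\<forall>t<r. W t < W r" "r = 0 \<longrightarrow> \<mu> ! 0 < \<nu> ! 0"
    using rest_closes_less_opens_iff[of r] by (auto simp: S_def)
  have "W s \<le> W r" if "r < s" "s < length \<kappa>" for s
    using that
  proof (induction s rule: less_induct)
    case (less s)
    then have "s \<notin> S" using max[of s] by auto
    then obtain t where "t < s" "W s \<le> W t"
      using rest_closes_less_opens_iff[of s] less.prems by (auto simp: S_def not_less)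
    then show ?case
    proof (cases t r rule: linorder_cases)
      case greater
      then have "W t \<le> W r" using less \<open>t < s\<close> by simp
      then show ?thesis using \<open>W s \<le> W t\<close> by simp
    qed (use r(2) in auto)
  qed
  then show ?thesis using r unfolding e_row_def by blast
qed

end

end

section \<open>Kashiwara operators on tableaux\<close>

lemma find_append_front:
  assumes "\<forall>x\<in>set xs. \<not> p x" "ys \<noteq> []" "\<forall>y\<in>set ys. p y"
  shows "find p (xs @ ys) = Some (hd ys)"
  using assms(1)
proof (induction xs)
  case Nil
  then show ?case using assms(2,3) by (cases ys) auto
qed simp

lemma upto_append:
  fixes i j k :: int
  assumes "i \<le> j + 1" "j \<le> k"
  shows "[i..k] = [i..j] @ [j + 1..k]"
proof (cases "i \<le> j")
  case False
  then have "i = j + 1" using assms(1) by simp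
  then show ?thesis by simp
qed (rule upto_split2[OF _ assms(2)])

lemma filter_upto_interval:
  fixes a b x y :: int
  assumes "x \<le> a" "a \<le> b" "b \<le> y"
  shows "filter (\<lambda>k. a < k \<and> k \<le> b) [x + 1..y] = [a + 1..b]" (is "filter ?p _ = _")
proof -
  have eq: "[x + 1..y] = [x + 1..a] @ [a + 1..y]" "[a + 1..y] = [a + 1..b] @ [b + 1..y]"
    by (rule upto_append; use assms in simp)+
  have 1: "filter ?p [x + 1..a] = []" and 3: "filter ?p [b + 1..y] = []"
    unfolding filter_empty_conv set_upto by simp_all
  have 2: "filter ?p [a + 1..b] = [a + 1..b]" unfolding filter_id_conv set_upto by simp
  show ?thesis by (simp only: eq filter_append 1 2 3 append_Nil append_Nil2)
qed

section \<open>Chains, fillings and relabelling of a cell\<close>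

locale tableau =
  fixes n :: nat and \<rho> l :: "int list" and P :: "int list list"
  assumes P: "P \<in> SST \<rho> l n"
begin

lemma length_P: "length P = n + 1" and nth_0: "P ! 0 = \<rho>" and nth_n: "P ! n = l"
  and chain: "i < n \<Longrightarrow> interlace (P ! i) (P ! (i + 1))"
  using P by (auto simp: SST_def)

lemma hd_P: "hd P = \<rho>" and last_P: "last P = l"
  using length_P nth_0 nth_n by (auto simp: hd_conv_nth last_conv_nth simp flip: length_greater_0_conv)

lemma length_nth: "i \<le> n \<Longrightarrow> length (P ! i) = length \<rho>"
proof (induction i)
  case (Suc i)
  then show ?case using chain[of i] by (simp add: interlace_def)
qed (simp add: nth_0)

lemma nth_mono:
  assumes "i \<le> i'" "i' \<le> n" "j < length \<rho>"
  shows "P ! i ! j \<le> P ! i' ! j"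
  using assms(1,2)
proof (induction i' rule: dec_induct)
  case (step m)
  then have "P ! m ! j \<le> P ! (m + 1) ! j"
    using chain[of m] length_nth[of m] assms(3) by (simp add: interlace_def)
  then show ?case using step by simp
qed simp

text \<open>Monotonicity of the chain makes the intervals
  \<open>P ! (i - 1) ! j < k \<le> P ! i ! j\<close> disjoint, and they exhaust the row of the skew
  shape. So the definite description in \<open>filling\<close> has exactly one candidate, and the
  guard on the shape is implied.\<close>

lemma filling_eq_Some:
  "filling P (j, k) = Some i \<longleftrightarrow>
     j < length \<rho> \<and> 1 \<le> i \<and> i \<le> n \<and> P ! (i - 1) ! j < k \<and> k \<le> P ! i ! j"
proof -
  let ?lab = "\<lambda>i. 1 \<le> i \<and> i < length P \<and> P ! (i - 1) ! j < k \<and> k \<le> P ! i ! j"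
  have unique: "i = i'" if "?lab i" "?lab i'" "j < length \<rho>" for i i'
  proof -
    have "\<not> a < b" if "?lab a" "?lab b" for a b
    proof
      assume "a < b"
      then have "P ! a ! j \<le> P ! (b - 1) ! j"
        using \<open>j < length \<rho>\<close> \<open>?lab b\<close> length_P by (intro nth_mono) auto
      then show False using that by simp
    qed
    then show ?thesis using that by (meson linorder_neqE_nat)
  qed
  have ex: "\<exists>i. ?lab i" if "j < length \<rho>" "\<rho> ! j < k" "k \<le> l ! j"
  proof -
    define m where "m = (LEAST m. k \<le> P ! m ! j)"
    have m: "k \<le> P ! m ! j" unfolding m_def by (rule LeastI[of _ n]) (use that nth_n in simp)
    have "m \<le> n" unfolding m_def by (rule Least_le) (use that nth_n in simp)
    moreover have "0 < m" using m that nth_0 by (cases m) auto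
    moreover have "P ! (m - 1) ! j < k"
      using not_less_Least[of "m - 1" "\<lambda>m. k \<le> P ! m ! j"] \<open>0 < m\<close> by (simp add: m_def[symmetric])
    ultimately show ?thesis using m length_P by (intro exI[of _ m]) auto
  qed
  have range: "\<rho> ! j < k \<and> k \<le> l ! j" if "?lab i" "j < length \<rho>" for i
  proof -
    have "P ! 0 ! j \<le> P ! (i - 1) ! j" "P ! i ! j \<le> P ! n ! j"
      using that length_P by (auto intro!: nth_mono)
    then show ?thesis using that by (simp add: nth_0 nth_n)
  qed
  show ?thesis
  proof (cases "j < length \<rho> \<and> \<rho> ! j < k \<and> k \<le> l ! j")
    case True
    then obtain i0 where i0: "?lab i0" using ex by blast
    then have "(THE i. ?lab i) = i0" using unique True by blast
    then have "filling P (j, k) = Some i0" using True by (simp add: filling_def hd_P last_P)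
    then show ?thesis using unique[OF i0, of i] i0 True length_P by auto
  next
    case False
    then have "filling P (j, k) = None" by (auto simp: filling_def hd_P last_P)
    then show ?thesis using range[of i] False length_P by auto
  qed
qed

text \<open>This recovers the chain from its filling and inner shape, which gives injectivity of
  \<open>filling\<close> and so uniqueness in \<open>relabel\<close>.\<close>

lemma le_nth_iff_filling:
  assumes "i \<le> n" "j < length \<rho>"
  shows "k \<le> P ! i ! j \<longleftrightarrow> k \<le> \<rho> ! j \<or> (\<exists>i'\<le>i. filling P (j, k) = Some i')"
proof
  assume k: "k \<le> P ! i ! j"
  show "k \<le> \<rho> ! j \<or> (\<exists>i'\<le>i. filling P (j, k) = Some i')"
  proof (rule disjCI)
    assume "\<not> (\<exists>i'\<le>i. filling P (j, k) = Some i')"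
    then have none: "filling P (j, k) \<noteq> Some m" if "m \<le> i" for m using that by blast
    have "k \<le> P ! (m - 1) ! j" if "k \<le> P ! m ! j" "m \<le> i" for m
    proof (rule ccontr)
      assume *: "\<not> k \<le> P ! (m - 1) ! j"
      then have "m \<noteq> 0" using that by (cases m) auto
      then have "filling P (j, k) = Some m" using * that assms by (simp add: filling_eq_Some)
      then show False using none that by blast
    qed
    then have "k \<le> P ! (i - m) ! j" for m
    proof (induction m)
      case (Suc m)
      then show ?case using Suc(2)[of "i - m"] by simp
    qed (simp add: k)
    from this[of i] show "k \<le> \<rho> ! j" by (simp add: nth_0)
  qed
next
  assume "k \<le> \<rho> ! j \<or> (\<exists>i'\<le>i. filling P (j, k) = Some i')"
  then show "k \<le> P ! i ! j"
    using nth_mono[of 0 i j] nth_mono[of _ i j] assms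
    by (auto simp: nth_0 filling_eq_Some intro: order.trans)
qed

end

lemma filling_inj:
  assumes "P \<in> SST \<rho> l n" "P' \<in> SST \<rho> l n" "filling P = filling P'"
  shows "P = P'"
proof -
  interpret P: tableau n \<rho> l P using assms(1) by unfold_locales
  interpret P': tableau n \<rho> l P' using assms(2) by unfold_locales
  show ?thesis
  proof (rule nth_equalityI)
    fix i assume "i < length P"
    then have i: "i \<le> n" using P.length_P by simp
    show "P ! i = P' ! i"
    proof (rule nth_equalityI)
      fix j assume "j < length (P ! i)"
      then have "k \<le> P ! i ! j \<longleftrightarrow> k \<le> P' ! i ! j" for k
        using P.le_nth_iff_filling[OF i] P'.le_nth_iff_filling[OF i] P.length_nth[OF i] assms(3) by simp
      then show "P ! i ! j = P' ! i ! j" by (meson order.antisym order.refl)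
    qed (simp add: P.length_nth P'.length_nth i)
  qed (simp add: P.length_P P'.length_P)
qed

context tableau
begin

lemma relabel_eqI:
  assumes "P' \<in> SST \<rho> l n" "filling P' = (filling P)(c \<mapsto> i)"
  shows "relabel n P c i = P'"
  unfolding relabel_def hd_P last_P
  by (rule the_equality) (use assms filling_inj in \<open>auto\<close>)

lemma update_SST:
  assumes i: "1 \<le> i" "i < n" and "interlace (P ! (i - 1)) \<mu>" "interlace \<mu> (P ! (i + 1))"
  shows "P[i := \<mu>] \<in> SST \<rho> l n"
  unfolding SST_def mem_Collect_eq
proof (intro conjI allI impI)
  show "P[i := \<mu>] ! 0 = \<rho>" "P[i := \<mu>] ! n = l" using i nth_0 nth_n by auto
next
  fix m assume "m \<le> n"
  then show "signature (P[i := \<mu>] ! m)"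
    using P assms(3) interlace_signature(2) length_P by (cases "m = i") (auto simp: SST_def)
next
  fix m assume "m < n"
  moreover from this have "interlace (P ! m) (P ! (m + 1))" by (rule chain)
  ultimately show "interlace (P[i := \<mu>] ! m) (P[i := \<mu>] ! (m + 1))"
    using assms length_P by (cases "m = i"; cases "m + 1 = i") auto
qed (simp add: length_P)

context
  fixes i :: nat
  assumes i: "1 \<le> i" "i < n"
begin

abbreviation (input) "\<kappa> \<equiv> P ! (i - 1)"
abbreviation (input) "\<mu> \<equiv> P ! i"
abbreviation (input) "\<nu> \<equiv> P ! (i + 1)"

definition "close_cells j = map (Pair j) [\<kappa> ! j + 1..\<mu> ! j]"
definition "open_cells j = map (Pair j) [\<mu> ! j + 1..\<nu> ! j]"

lemma \<kappa>\<mu>: "interlace \<kappa> \<mu>" and \<mu>\<nu>: "interlace \<mu> \<nu>"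
  using chain[of "i - 1"] chain[of i] i by auto

lemma length_\<kappa>: "length \<kappa> = length \<rho>"
  using length_nth[of "i - 1"] i by simp

lemma filling_close_cells: "c \<in> set (close_cells j) \<Longrightarrow> j < length \<rho> \<Longrightarrow> filling P c = Some i"
  using i by (auto simp: close_cells_def filling_eq_Some)

lemma filling_open_cells: "c \<in> set (open_cells j) \<Longrightarrow> j < length \<rho> \<Longrightarrow> filling P c = Some (i + 1)"
  using i by (auto simp: open_cells_def filling_eq_Some)

text \<open>In each row the labels \<open>i\<close> and \<open>i + 1\<close> occupy two consecutive
  intervals of columns, closing brackets first.\<close>

lemma bracket_cells:
  "filter (\<lambda>c. filling P c \<in> {Some i, Some (i + 1)}) (reading_cells \<rho> l) =
     concat (map (\<lambda>j. close_cells j @ open_cells j) (rev [0..<length \<rho>]))"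
proof -
  have row: "filter (\<lambda>c. filling P c \<in> {Some i, Some (i + 1)}) (map (Pair j) [\<rho> ! j + 1..l ! j]) =
      close_cells j @ open_cells j" if j: "j < length \<rho>" for j
  proof -
    have le: "\<rho> ! j \<le> \<kappa> ! j" "\<kappa> ! j \<le> \<mu> ! j" "\<mu> ! j \<le> \<nu> ! j" "\<nu> ! j \<le> l ! j"
      using nth_mono[of 0 "i - 1" j] nth_mono[of "i - 1" i j] nth_mono[of i "i + 1" j]
        nth_mono[of "i + 1" n j] i j by (auto simp: nth_0 nth_n)
    have "filling P (j, k) \<in> {Some i, Some (i + 1)} \<longleftrightarrow> \<kappa> ! j < k \<and> k \<le> \<nu> ! j" for k
      using le i j by (auto simp: filling_eq_Some)
    then have "filter (\<lambda>c. filling P c \<in> {Some i, Some (i + 1)}) (map (Pair j) [\<rho> ! j + 1..l ! j]) =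
        map (Pair j) (filter (\<lambda>k. \<kappa> ! j < k \<and> k \<le> \<nu> ! j) [\<rho> ! j + 1..l ! j])"
      by (simp add: filter_map comp_def del: insert_iff)
    also have "\<dots> = map (Pair j) [\<kappa> ! j + 1..\<nu> ! j]"
      using le by (subst filter_upto_interval) auto
    also have "[\<kappa> ! j + 1..\<nu> ! j] = [\<kappa> ! j + 1..\<mu> ! j] @ [\<mu> ! j + 1..\<nu> ! j]"
      using le by (intro upto_append) auto
    finally show ?thesis by (simp add: close_cells_def open_cells_def)
  qed
  then show ?thesis
    unfolding reading_cells_def filter_concat map_map comp_def
    by (intro arg_cong[where f = concat] map_cong) auto
qed

lemma remaining_brackets_eq:
  "remaining_brackets i P =
     rest_closes close_cells open_cells (length \<rho>) @ rest_opens close_cells open_cells (length \<rho>)"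
proof -
  have "remaining_brackets i P = foldr (reduce_step (\<lambda>c. filling P c = Some (i + 1)) (\<lambda>c. filling P c = Some i))
      (concat (map (\<lambda>j. close_cells j @ open_cells j) (rev [0..<length \<rho>]))) []"
    unfolding remaining_brackets_def hd_P last_P bracket_cells reduce_step_def ..
  also have "\<dots> = rest_closes close_cells open_cells (length \<rho>) @ rest_opens close_cells open_cells (length \<rho>)"
  proof (rule foldr_reduce_rows)
    show "filling P c = Some i \<and> filling P c \<noteq> Some (i + 1)"
      if "j < length \<rho>" "c \<in> set (close_cells j)" for j c using filling_close_cells[OF that(2,1)] by simp
    show "filling P c = Some (i + 1) \<and> filling P c \<noteq> Some i"
      if "j < length \<rho>" "c \<in> set (open_cells j)" for j c using filling_open_cells[OF that(2,1)] by simp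
  qed
  finally show ?thesis .
qed

lemma filling_rest_closes:
  "\<forall>c\<in>set (rest_closes close_cells open_cells (length \<rho>)). filling P c = Some i"
  using filling_close_cells by (auto dest!: set_rest_closes)

lemma filling_rest_opens:
  "\<forall>c\<in>set (rest_opens close_cells open_cells (length \<rho>)). filling P c = Some (i + 1)"
  using filling_open_cells by (auto dest!: set_rest_opens)

lemma length_close_cells: "s < length \<kappa> \<Longrightarrow> int (length (close_cells s)) = \<mu> ! s - \<kappa> ! s"
  using \<kappa>\<mu> by (simp add: close_cells_def interlace_def)

lemma length_open_cells: "s < length \<kappa> \<Longrightarrow> int (length (open_cells s)) = \<nu> ! s - \<mu> ! s"
  using \<kappa>\<mu> \<mu>\<nu> by (simp add: open_cells_def interlace_def)

lemmas row_facts = \<kappa>\<mu> \<mu>\<nu> length_close_cells length_open_cells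

lemma last_close_cells: "\<kappa> ! r < \<mu> ! r \<Longrightarrow> last (close_cells r) = (r, \<mu> ! r)"
  by (simp add: close_cells_def last_map upto_rec2)

lemma hd_open_cells: "\<mu> ! r < \<nu> ! r \<Longrightarrow> hd (open_cells r) = (r, \<mu> ! r + 1)"
  by (simp add: open_cells_def hd_map upto_rec1)

text \<open>Moving the border between the labels \<open>i\<close> and \<open>i + 1\<close> in one
  row by one column relabels exactly the cell it passes. The disjunction in \<open>v\<close> treats
  lowering and raising together.\<close>

lemma filling_update:
  assumes r: "r < length \<rho>" and \<mu>': "interlace \<kappa> (\<mu>[r := v])" "interlace (\<mu>[r := v]) \<nu>"
    and v: "v = \<mu> ! r - 1 \<and> c = (r, \<mu> ! r) \<and> m = i + 1 \<or> v = \<mu> ! r + 1 \<and> c = (r, \<mu> ! r + 1) \<and> m = i"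
  shows "filling (P[i := \<mu>[r := v]]) = (filling P)(c \<mapsto> m)"
proof
  fix d :: cell
  obtain j k where d: "d = (j, k)" by (cases d)
  have P': "P[i := \<mu>[r := v]] \<in> SST \<rho> l n" using update_SST[OF i \<mu>'] .
  interpret P': tableau n \<rho> l "P[i := \<mu>[r := v]]" using P' by unfold_locales
  have v_bounds: "\<kappa> ! r \<le> v" "v \<le> \<nu> ! r"
    "\<kappa> ! r \<le> \<mu> ! r" "\<mu> ! r \<le> \<nu> ! r"
    using \<mu>'[THEN interlace_nth_le, of r] \<kappa>\<mu>[THEN interlace_nth_le, of r] \<mu>\<nu>[THEN interlace_nth_le, of r]
      r length_\<kappa> length_nth[of i] i by simp_all
  have nth: "P[i := \<mu>[r := v]] ! q ! j = (if q = i \<and> j = r then v else P ! q ! j)" for q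
    using r i length_P length_nth[of i] by (auto simp: nth_list_update)
  have "filling (P[i := \<mu>[r := v]]) (j, k) = Some q \<longleftrightarrow> ((filling P)(c \<mapsto> m)) (j, k) = Some q" for q
  proof (cases "(j, k) = c")
    case True
    then have jk: "j = r" "v = k - 1 \<and> m = i + 1 \<and> k = \<mu> ! r \<or> v = k \<and> m = i \<and> k = \<mu> ! r + 1"
      using v by auto
    have "filling (P[i := \<mu>[r := v]]) (j, k) = Some m"
      unfolding P'.filling_eq_Some nth using jk r i v_bounds by auto
    then show ?thesis using True by auto
  next
    case False
    then have jk: "j \<noteq> r \<or> (v = \<mu> ! r - 1 \<and> k \<noteq> \<mu> ! r) \<or> (v = \<mu> ! r + 1 \<and> k \<noteq> \<mu> ! r + 1)"
      using v by auto
    have "((filling P)(c \<mapsto> m)) (j, k) = filling P (j, k)" using False by simp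
    moreover have "P[i := \<mu>[r := v]] ! (q - 1) ! j < k \<longleftrightarrow> P ! (q - 1) ! j < k"
      "k \<le> P[i := \<mu>[r := v]] ! q ! j \<longleftrightarrow> k \<le> P ! q ! j"
      unfolding nth using jk by auto
    ultimately show ?thesis by (simp only: P'.filling_eq_Some filling_eq_Some)
  qed
  then show "filling (P[i := \<mu>[r := v]]) d = ((filling P)(c \<mapsto> m)) d"
    unfolding d by (metis not_None_eq)
qed

text \<open>In the reduced word all closing brackets precede the opening ones, so the backward
  search skips the latter and stops at the last survivor, which is the last cell of label
  \<open>i\<close> in the row selected by \<open>f_row\<close>.\<close>

lemma kash_f_eq_Some_iff:
  "kash_f n i P = Some P' \<longleftrightarrow> (\<exists>r. f_row \<kappa> \<mu> \<nu> r \<and> P' = P[i := \<mu>[r := \<mu> ! r - 1]])"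
proof -
  have some: "kash_f n i P = Some (P[i := \<mu>[r := \<mu> ! r - 1]])" if r: "f_row \<kappa> \<mu> \<nu> r" for r
  proof -
    let ?A = "rest_closes close_cells open_cells (length \<rho>)"
    let ?B = "rest_opens close_cells open_cells (length \<rho>)"
    have A: "?A \<noteq> []" "last ?A = last (close_cells r)"
      using last_rest_closes[OF row_facts r] unfolding length_\<kappa> by simp_all
    have "find (\<lambda>c. filling P c = Some i) (rev ?B @ rev ?A) = Some (hd (rev ?A))"
      using A filling_rest_closes filling_rest_opens by (intro find_append_front) auto
    then have "find (\<lambda>c. filling P c = Some i) (rev (remaining_brackets i P)) = Some (r, \<mu> ! r)"
      using A f_row_gap(1)[OF \<kappa>\<mu> \<mu>\<nu> r] by (simp add: remaining_brackets_eq hd_rev last_close_cells)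
    moreover have "relabel n P (r, \<mu> ! r) (i + 1) = P[i := \<mu>[r := \<mu> ! r - 1]]"
    proof (rule relabel_eqI)
      note inter = f_row_interlace[OF \<kappa>\<mu> \<mu>\<nu> r]
      show "P[i := \<mu>[r := \<mu> ! r - 1]] \<in> SST \<rho> l n" using update_SST[OF i inter] .
      show "filling (P[i := \<mu>[r := \<mu> ! r - 1]]) = (filling P)((r, \<mu> ! r) \<mapsto> i + 1)"
        by (rule filling_update[OF _ inter]) (use r length_\<kappa> in \<open>auto simp: f_row_def\<close>)
    qed
    ultimately show ?thesis by (simp add: kash_f_def)
  qed
  have "kash_f n i P = None" if "\<nexists>r. f_row \<kappa> \<mu> \<nu> r"
  proof -
    have "rest_closes close_cells open_cells (length \<rho>) = []"
      using rest_closes_nonempty[OF row_facts] that unfolding length_\<kappa> by blast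
    then have "find (\<lambda>c. filling P c = Some i) (rev (remaining_brackets i P)) = None"
      using filling_rest_opens by (auto simp: remaining_brackets_eq find_None_iff)
    then show ?thesis by (simp add: kash_f_def)
  qed
  with some show ?thesis by (metis option.distinct(1) option.inject)
qed

lemma kash_e_eq_Some_iff:
  "kash_e n i P = Some P' \<longleftrightarrow> (\<exists>r. e_row \<kappa> \<mu> \<nu> r \<and> P' = P[i := \<mu>[r := \<mu> ! r + 1]])"
proof -
  have some: "kash_e n i P = Some (P[i := \<mu>[r := \<mu> ! r + 1]])" if r: "e_row \<kappa> \<mu> \<nu> r" for r
  proof -
    let ?A = "rest_closes close_cells open_cells (length \<rho>)"
    let ?B = "rest_opens close_cells open_cells (length \<rho>)"
    have B: "?B \<noteq> []" "hd ?B = hd (open_cells r)"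
      using hd_rest_opens[OF row_facts r] unfolding length_\<kappa> by simp_all
    have "find (\<lambda>c. filling P c = Some (i + 1)) (?A @ ?B) = Some (hd ?B)"
      using B filling_rest_closes filling_rest_opens by (intro find_append_front) auto
    then have "find (\<lambda>c. filling P c = Some (i + 1)) (remaining_brackets i P) = Some (r, \<mu> ! r + 1)"
      using B e_row_gap(1)[OF \<kappa>\<mu> \<mu>\<nu> r] by (simp add: remaining_brackets_eq hd_open_cells)
    moreover have "relabel n P (r, \<mu> ! r + 1) i = P[i := \<mu>[r := \<mu> ! r + 1]]"
    proof (rule relabel_eqI)
      note inter = e_row_interlace[OF \<kappa>\<mu> \<mu>\<nu> r]
      show "P[i := \<mu>[r := \<mu> ! r + 1]] \<in> SST \<rho> l n" using update_SST[OF i inter] .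
      show "filling (P[i := \<mu>[r := \<mu> ! r + 1]]) = (filling P)((r, \<mu> ! r + 1) \<mapsto> i)"
        by (rule filling_update[OF _ inter]) (use r length_\<kappa> in \<open>auto simp: e_row_def\<close>)
    qed
    ultimately show ?thesis by (simp add: kash_e_def)
  qed
  have "kash_e n i P = None" if "\<nexists>r. e_row \<kappa> \<mu> \<nu> r"
  proof -
    have "rest_opens close_cells open_cells (length \<rho>) = []"
      using rest_opens_nonempty[OF row_facts] that unfolding length_\<kappa> by blast
    then have "find (\<lambda>c. filling P c = Some (i + 1)) (remaining_brackets i P) = None"
      using filling_rest_closes by (auto simp: remaining_brackets_eq find_None_iff)
    then show ?thesis by (simp add: kash_e_def)
  qed
  with some show ?thesis by (metis option.distinct(1) option.inject)
qed

end

end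

lemma kash_f_SST:
  assumes "P \<in> SST \<rho> l n" "1 \<le> i" "i < n" "kash_f n i P = Some P'"
  shows "P' \<in> SST \<rho> l n" "kash_e n i P' = Some P"
proof -
  interpret tableau n \<rho> l P using assms(1) by unfold_locales
  obtain r where r: "f_row (P ! (i - 1)) (P ! i) (P ! (i + 1)) r"
    and P': "P' = P[i := (P ! i)[r := P ! i ! r - 1]]"
    using kash_f_eq_Some_iff[OF assms(2,3)] assms(4) by blast
  have inter: "interlace (P ! (i - 1)) (P ! i)" "interlace (P ! i) (P ! (i + 1))"
    using chain[of "i - 1"] chain[of i] assms by auto
  show SST: "P' \<in> SST \<rho> l n"
    unfolding P' by (rule update_SST[OF assms(2,3) f_row_interlace[OF inter r]])
  interpret P': tableau n \<rho> l P' using SST by unfold_locales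
  have r_len: "r < length (P ! i)" using r inter(1) by (simp add: f_row_def interlace_def)
  have nth: "P' ! (i - 1) = P ! (i - 1)" "P' ! i = (P ! i)[r := P ! i ! r - 1]" "P' ! (i + 1) = P ! (i + 1)"
    using assms(2,3) length_P by (auto simp: P')
  show "kash_e n i P' = Some P"
    unfolding P'.kash_e_eq_Some_iff[OF assms(2,3)] nth
    using f_row_imp_e_row[OF inter r] r_len by (auto simp: P' intro!: exI[of _ r])
qed

lemma kash_e_SST:
  assumes "P \<in> SST \<rho> l n" "1 \<le> i" "i < n" "kash_e n i P = Some P'"
  shows "P' \<in> SST \<rho> l n" "kash_f n i P' = Some P"
proof -
  interpret tableau n \<rho> l P using assms(1) by unfold_locales
  obtain r where r: "e_row (P ! (i - 1)) (P ! i) (P ! (i + 1)) r"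
    and P': "P' = P[i := (P ! i)[r := P ! i ! r + 1]]"
    using kash_e_eq_Some_iff[OF assms(2,3)] assms(4) by blast
  have inter: "interlace (P ! (i - 1)) (P ! i)" "interlace (P ! i) (P ! (i + 1))"
    using chain[of "i - 1"] chain[of i] assms by auto
  show SST: "P' \<in> SST \<rho> l n"
    unfolding P' by (rule update_SST[OF assms(2,3) e_row_interlace[OF inter r]])
  interpret P': tableau n \<rho> l P' using SST by unfold_locales
  have r_len: "r < length (P ! i)" using r inter(1) by (simp add: e_row_def interlace_def)
  have nth: "P' ! (i - 1) = P ! (i - 1)" "P' ! i = (P ! i)[r := P ! i ! r + 1]" "P' ! (i + 1) = P ! (i + 1)"
    using assms(2,3) length_P by (auto simp: P')
  show "kash_f n i P' = Some P"
    unfolding P'.kash_f_eq_Some_iff[OF assms(2,3)] nth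
    using e_row_imp_f_row[OF inter r] r_len by (auto simp: P' intro!: exI[of _ r])
qed

section \<open>Fields on the cylinder\<close>

text \<open>Periodicity is asked for the generating shift only, and the rule is the row relation;
  monotonicity and constant length of the entries come from interlacing.\<close>

definition cylinder_field :: "nat \<Rightarrow> (int \<times> int \<Rightarrow> int list) \<Rightarrow> bool" where
  "cylinder_field n F \<longleftrightarrow> (\<forall>x y. F (x + int n, y - int n) = F (x, y) \<and>
     interlace (F (x, y)) (F (x + 1, y)) \<and> interlace (F (x, y)) (F (x, y + 1)) \<and>
     local_rule (F (x, y)) (F (x + 1, y)) (F (x, y + 1)) (F (x + 1, y + 1)))"

lemma cylinder_fieldD:
  assumes "cylinder_field n F"
  shows "F (x + int n, y - int n) = F (x, y)" "interlace (F (x, y)) (F (x + 1, y))"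
    "interlace (F (x, y)) (F (x, y + 1))"
    "local_rule (F (x, y)) (F (x + 1, y)) (F (x, y + 1)) (F (x + 1, y + 1))"
  using assms unfolding cylinder_field_def by blast+

lemma cylinder_field_periodic:
  assumes "cylinder_field n F"
  shows "F (x + k * int n, y - k * int n) = F (x, y)"
proof (induction k rule: int_induct[where k = 0])
  case (step1 k)
  then show ?case
    using cylinder_fieldD(1)[OF assms, of "x + k * int n" "y - k * int n"] by (simp add: algebra_simps)
next
  case (step2 k)
  then show ?case
    using cylinder_fieldD(1)[OF assms, of "x + (k - 1) * int n" "y - (k - 1) * int n"]
    by (simp add: algebra_simps)
qed simp

lemma cylinder_field_length:
  assumes "cylinder_field n F"
  shows "length (F p) = length (F (0, 0))"
proof -
  have row: "length (F (x, y)) = length (F (0, y))" for x y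
  proof (induction x rule: int_induct[where k = 0])
    case (step1 x)
    then show ?case using cylinder_fieldD(2)[OF assms, of x y] by (simp add: interlace_def)
  next
    case (step2 x)
    then show ?case using cylinder_fieldD(2)[OF assms, of "x - 1" y] by (simp add: interlace_def)
  qed simp
  have col: "length (F (0, y)) = length (F (0, 0))" for y
  proof (induction y rule: int_induct[where k = 0])
    case (step1 y)
    then show ?case using cylinder_fieldD(3)[OF assms, of 0 y] by (simp add: interlace_def)
  next
    case (step2 y)
    then show ?case using cylinder_fieldD(3)[OF assms, of 0 "y - 1"] by (simp add: interlace_def)
  qed simp
  show ?thesis using row[of "fst p" "snd p"] col[of "snd p"] by simp
qed

lemma Fomin_field_iff:
  "Fomin_field n len F \<longleftrightarrow> cylinder_field n F \<and> length (F (0, 0)) = len"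
proof
  assume F: "Fomin_field n len F"
  have "F (x + int n, y - int n) = F (x, y)" for x y
  proof -
    have "((x, y), (x + 1 * int n, y - 1 * int n)) \<in> cylinder_rel n"
      unfolding cylinder_rel_def by blast
    moreover have "F respects (cylinder_rel n)" using F unfolding Fomin_field_def by blast
    ultimately have "F (x, y) = F (x + 1 * int n, y - 1 * int n)" by (rule congruentD[rotated])
    then show ?thesis by simp
  qed
  moreover have "interlace (F (x, y)) (F (x + 1, y))" "interlace (F (x, y)) (F (x, y + 1))"
    "F (x + 1, y + 1) = Fomin_rule (F (x, y)) (F (x + 1, y)) (F (x, y + 1))" for x y
    using F unfolding Fomin_field_def by blast+
  moreover from this have "local_rule (F (x, y)) (F (x + 1, y)) (F (x, y + 1)) (F (x + 1, y + 1))" for x y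
    using Fomin_rule_iff by blast
  ultimately have "cylinder_field n F" unfolding cylinder_field_def by blast
  moreover have "length (F (0, 0)) = len" using F unfolding Fomin_field_def by blast
  ultimately show "cylinder_field n F \<and> length (F (0, 0)) = len" ..
next
  assume F: "cylinder_field n F \<and> length (F (0, 0)) = len"
  have "F respects (cylinder_rel n)"
  proof (rule congruentI)
    fix a b assume "(a, b) \<in> cylinder_rel n"
    then obtain x y k where "a = (x, y)" "b = (x + k * int n, y - k * int n)"
      unfolding cylinder_rel_def by blast
    then show "F a = F b" using cylinder_field_periodic[of n F x k y] F by simp
  qed
  moreover have "signature (F p)" for p
    using interlace_signature(1)[OF cylinder_fieldD(2)] F by (cases p) blast
  moreover have "length (F p) = len" for p using F cylinder_field_length by blast
  moreover have "F (x + 1, y + 1) = Fomin_rule (F (x, y)) (F (x + 1, y)) (F (x, y + 1))" for x y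
    using Fomin_rule_iff cylinder_fieldD(2-4)[of n F x y] F by blast
  ultimately show "Fomin_field n len F"
    using F cylinder_fieldD(2,3)[of n F] unfolding Fomin_field_def by blast
qed

section \<open>Fields and pairs of tableaux\<close>

definition boundary :: "nat \<Rightarrow> (int \<times> int \<Rightarrow> int list) \<Rightarrow> tableau_pair" where
  "boundary n F = (map (\<lambda>i. F (int i, 0)) [0..<n+1], map (\<lambda>i. F (0, int i)) [0..<n+1])"

text \<open>Periodicity identifies \<open>(n, 0)\<close> with \<open>(0, n)\<close>, so both
  tableaux end in the same shape.\<close>

lemma boundary_SST_pairs:
  assumes "cylinder_field n F"
  shows "boundary n F \<in> SST_pairs n"
proof -
  note D = cylinder_fieldD[OF assms]
  have sig: "signature (F (x, y))" for x y using D(2) interlace_signature(1) by blast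
  have "F (int n, 0) = F (0, int n)" using D(1)[of 0 "int n"] by simp
  moreover have "interlace (F (int i, 0)) (F (int (Suc i), 0))" "interlace (F (0, int i)) (F (0, int (Suc i)))" for i
    using D(2)[of "int i" 0] D(3)[of 0 "int i"] by (simp_all add: add.commute)
  ultimately have "fst (boundary n F) \<in> SST (F (0, 0)) (F (0, int n)) n"
    "snd (boundary n F) \<in> SST (F (0, 0)) (F (0, int n)) n"
    by (auto simp: boundary_def SST_def sig nth_append nth_Cons simp del: of_nat_Suc upt_Suc)
  then show ?thesis using sig unfolding SST_pairs_def by (cases "boundary n F") auto
qed

lemma boundary_eqD:
  assumes "boundary n F = boundary n G" "i \<le> n"
  shows "F (int i, 0) = G (int i, 0)" "F (0, int i) = G (0, int i)"
  using assms by (auto simp: boundary_def less_Suc_eq_le simp del: upt_Suc)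

text \<open>Agreement spreads along hooks with corner \<open>(x, 0)\<close>: the column to the right
  is determined from below by the forward rule, the one to the left from above by the backward rule.
  Periodicity supplies the far end \<open>(x + 1 + n, 0)\<close> on the right and the starting point
  \<open>(x - 1, n)\<close> on the left.\<close>

lemma cylinder_field_unique:
  assumes F: "cylinder_field n F" and G: "cylinder_field n G" and n: "1 \<le> n"
    and eq: "boundary n F = boundary n G"
  shows "F = G"
proof -
  note DF = cylinder_fieldD[OF F] and DG = cylinder_fieldD[OF G]
  define agree where "agree x \<longleftrightarrow> (\<forall>i\<le>n. F (x + int i, 0) = G (x + int i, 0) \<and> F (x, int i) = G (x, int i))"
    for x
  have agree: "agree x" for x
  proof (induction x rule: int_induct[where k = 0])
    case base
    then show ?case using boundary_eqD[OF eq] by (simp add: agree_def)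
  next
    case (step1 x)
    have col: "F (x + 1, int y) = G (x + 1, int y)" if "y \<le> n" for y
      using that
    proof (induction y)
      case 0
      then show ?case using step1(2) n unfolding agree_def by (metis of_nat_0 of_nat_1)
    next
      case (Suc y)
      have "F (x, int y) = G (x, int y)" "F (x, int (Suc y)) = G (x, int (Suc y))"
        using step1(2) Suc.prems by (auto simp: agree_def simp del: of_nat_Suc)
      then show ?case
        using DF(4)[of x "int y"] DG(4)[of x "int y"] Suc
        by (auto simp: add.commute intro: local_rule_unique)
    qed
    moreover have "F (x + 1 + int i, 0) = G (x + 1 + int i, 0)" if "i \<le> n" for i
    proof (cases "i = n")
      case True
      then show ?thesis using DF(1)[of "x + 1" "int n"] DG(1)[of "x + 1" "int n"] col[of n] by simp
    next
      case False
      then have "F (x + int (Suc i), 0) = G (x + int (Suc i), 0)"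
        using step1(2) that unfolding agree_def by (metis Suc_leI le_neq_implies_less)
      then show ?thesis by (simp add: add.assoc)
    qed
    ultimately show ?case by (simp add: agree_def)
  next
    case (step2 x)
    have col: "F (x - 1, int y) = G (x - 1, int y)" if "y \<le> n" for y
      using that
    proof (induction rule: inc_induct)
      case base
      have "F (x + int (n - 1), 0) = G (x + int (n - 1), 0)" using step2(2) by (simp add: agree_def)
      then show ?case
        using DF(1)[of "x - 1" "int n"] DG(1)[of "x - 1" "int n"] n by (simp add: of_nat_diff algebra_simps)
    next
      case (step y)
      have "F (x, int y) = G (x, int y)" "F (x, int (Suc y)) = G (x, int (Suc y))"
        using step2(2) step.hyps by (auto simp: agree_def simp del: of_nat_Suc)
      then show ?case
        using DF(4)[of "x - 1" "int y"] DG(4)[of "x - 1" "int y"] step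
        by (auto simp: add.commute intro: local_rule_unique_backward)
    qed
    moreover have "F (x - 1 + int i, 0) = G (x - 1 + int i, 0)" if "i \<le> n" for i
    proof (cases i)
      case 0
      then show ?thesis using col[of 0] by simp
    next
      case (Suc m)
      have "F (x + int m, 0) = G (x + int m, 0)" using step2(2) that Suc by (simp add: agree_def)
      then show ?thesis by (simp add: Suc)
    qed
    ultimately show ?case by (simp add: agree_def)
  qed
  show "F = G"
  proof
    fix p :: "int \<times> int"
    obtain x y where p: "p = (x, y)" by (cases p)
    \<comment> \<open>Each point is equivalent to one of height between 0 and \<open>n - 1\<close>,
      a range covered by the hooks.\<close>
    define k where "k = y div int n"
    have "y - k * int n = y mod int n" by (simp add: k_def minus_div_mult_eq_mod)
    moreover have "0 \<le> y mod int n" "y mod int n < int n" using n by simp_all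
    ultimately obtain r where r: "y - k * int n = int r" "r \<le> n"
      by (metis nonneg_int_cases of_nat_less_iff order.strict_implies_order)
    have "F (x + k * int n, y - k * int n) = G (x + k * int n, y - k * int n)"
      using agree[of "x + k * int n"] r by (simp add: agree_def)
    then show "F p = G p" using cylinder_field_periodic[OF F] cylinder_field_periodic[OF G] p by simp
  qed
qed

section \<open>Construction of a field from its boundary\<close>

lemma column_forward:
  assumes "\<And>y. y < n \<Longrightarrow> interlace (q y) (q (Suc y))" "interlace (q 0) s"
  shows "\<exists>q'. q' 0 = s \<and> (\<forall>y\<le>n. interlace (q y) (q' y)) \<and>
    (\<forall>y<n. interlace (q' y) (q' (Suc y)) \<and> local_rule (q y) (q' y) (q (Suc y)) (q' (Suc y)))"
  using assms(1)
proof (induction n)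
  case 0
  then show ?case using assms(2) by auto
next
  case (Suc n)
  then obtain q' where q': "q' 0 = s" "\<And>y. y \<le> n \<Longrightarrow> interlace (q y) (q' y)"
    "\<And>y. y < n \<Longrightarrow> interlace (q' y) (q' (Suc y)) \<and> local_rule (q y) (q' y) (q (Suc y)) (q' (Suc y))"
    by (metis less_SucI)
  obtain \<nu> where "local_rule (q n) (q' n) (q (Suc n)) \<nu>" "interlace (q' n) \<nu>" "interlace (q (Suc n)) \<nu>"
    using local_rule_exists[OF q'(2)[of n] Suc.prems[of n]] by auto
  then show ?case using q' by (intro exI[of _ "q'(Suc n := \<nu>)"]) (auto simp: less_Suc_eq le_Suc_eq)
qed

lemma column_backward:
  assumes "\<And>y. y < n \<Longrightarrow> interlace (q' y) (q' (Suc y))" "interlace s (q' n)"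
  shows "\<exists>q. q n = s \<and> (\<forall>y\<le>n. interlace (q y) (q' y)) \<and>
    (\<forall>y<n. interlace (q y) (q (Suc y)) \<and> local_rule (q y) (q' y) (q (Suc y)) (q' (Suc y)))"
  using assms
proof (induction n arbitrary: s)
  case 0
  then show ?case by (intro exI[of _ "\<lambda>_. s"]) simp
next
  case (Suc n)
  obtain \<kappa> where \<kappa>: "local_rule \<kappa> (q' n) s (q' (Suc n))" "interlace \<kappa> (q' n)" "interlace \<kappa> s"
    using local_rule_exists_backward[OF Suc.prems(1)[of n] Suc.prems(2)] by auto
  obtain q where q: "q n = \<kappa>" "\<And>y. y \<le> n \<Longrightarrow> interlace (q y) (q' y)"
    "\<And>y. y < n \<Longrightarrow> interlace (q y) (q (Suc y)) \<and> local_rule (q y) (q' y) (q (Suc y)) (q' (Suc y))"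
    using Suc.IH[OF Suc.prems(1) \<kappa>(2)] by (metis less_SucI)
  then show ?case
    using \<kappa> Suc.prems(2) by (intro exI[of _ "q(Suc n := s)"]) (auto simp: less_Suc_eq le_Suc_eq)
qed

lemma bi_infinite_orbit:
  assumes fwd: "\<And>a. S a \<Longrightarrow> \<exists>b. S b \<and> R a b" and bwd: "\<And>b. S b \<Longrightarrow> \<exists>a. S a \<and> R a b"
    and s0: "S s0"
  shows "\<exists>s :: int \<Rightarrow> 'a. s 0 = s0 \<and> (\<forall>k. S (s k) \<and> R (s k) (s (k + 1)))"
proof -
  obtain f :: "nat \<Rightarrow> 'a" where f: "f 0 = s0" "\<And>k. S (f k)" "\<And>k. R (f k) (f (Suc k))"
  proof -
    have "\<exists>f. \<forall>k. (S (f k) \<and> (k = 0 \<longrightarrow> f k = s0)) \<and> R (f k) (f (Suc k))"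
      by (rule dependent_nat_choice) (use s0 fwd in auto)
    then show thesis using that by blast
  qed
  obtain g :: "nat \<Rightarrow> 'a" where g: "g 0 = s0" "\<And>k. S (g k)" "\<And>k. R (g (Suc k)) (g k)"
  proof -
    have "\<exists>g. \<forall>k. (S (g k) \<and> (k = 0 \<longrightarrow> g k = s0)) \<and> R (g (Suc k)) (g k)"
      by (rule dependent_nat_choice) (use s0 bwd in auto)
    then show thesis using that by blast
  qed
  define s where "s k = (if 0 \<le> k then f (nat k) else g (nat (- k)))" for k
  have "R (s k) (s (k + 1))" for k
  proof (cases "0 \<le> k")
    case True
    then show ?thesis using f(3)[of "nat k"] by (simp add: s_def nat_add_distrib)
  next
    case False
    then have "nat (- k) = Suc (nat (- (k + 1)))" by simp
    then have "R (g (nat (- k))) (g (nat (- (k + 1))))" using g(3) by simp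
    moreover have "s (k + 1) = g (nat (- (k + 1)))" using False f(1) g(1) by (auto simp: s_def)
    ultimately show ?thesis using False by (simp add: s_def)
  qed
  moreover have "s 0 = s0" "\<And>k. S (s k)" using f g by (auto simp: s_def)
  ultimately show ?thesis by blast
qed

text \<open>The two functions are the horizontal and the vertical arm of a hook in a field. Equality
  at \<open>n\<close> encodes the periodicity of the cylinder.\<close>

definition hook :: "nat \<Rightarrow> (nat \<Rightarrow> int list) \<times> (nat \<Rightarrow> int list) \<Rightarrow> bool" where
  "hook n = (\<lambda>(p, q). p 0 = q 0 \<and> p n = q n \<and>
     (\<forall>i<n. interlace (p i) (p (Suc i)) \<and> interlace (q i) (q (Suc i))))"

text \<open>The corner moves one step to the right. The far end of the new horizontal arm is tied to
  \<open>q' n\<close> by \<open>hook\<close>.\<close>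

definition hook_step :: "nat \<Rightarrow> (nat \<Rightarrow> int list) \<times> (nat \<Rightarrow> int list) \<Rightarrow>
    (nat \<Rightarrow> int list) \<times> (nat \<Rightarrow> int list) \<Rightarrow> bool" where
  "hook_step n = (\<lambda>(p, q) (p', q'). (\<forall>i<n. p' i = p (Suc i)) \<and> (\<forall>y\<le>n. interlace (q y) (q' y)) \<and>
     (\<forall>y<n. local_rule (q y) (q' y) (q (Suc y)) (q' (Suc y))))"

lemma hook_step_exists:
  assumes "hook n pq" "1 \<le> n"
  shows "\<exists>pq'. hook n pq' \<and> hook_step n pq pq'"
proof -
  obtain p q where pq: "pq = (p, q)" by (cases pq)
  have h: "p 0 = q 0" "p n = q n" "\<And>i. i < n \<Longrightarrow> interlace (p i) (p (Suc i))"
    "\<And>i. i < n \<Longrightarrow> interlace (q i) (q (Suc i))" using assms(1) by (auto simp: pq hook_def)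
  have "interlace (q 0) (p 1)" using h(1) h(3)[of 0] assms(2) by simp
  then obtain q' where q': "q' 0 = p 1" "\<And>y. y \<le> n \<Longrightarrow> interlace (q y) (q' y)"
    "\<And>y. y < n \<Longrightarrow> interlace (q' y) (q' (Suc y)) \<and> local_rule (q y) (q' y) (q (Suc y)) (q' (Suc y))"
    using column_forward[of n q "p 1"] h(4) by blast
  define p' where "p' i = (if i < n then p (Suc i) else q' n)" for i
  have "interlace (p' i) (p' (Suc i))" if "i < n" for i
  proof (cases "Suc i < n")
    case True
    then show ?thesis using h(3) by (simp add: p'_def)
  next
    case False
    then have "Suc i = n" using that by simp
    then show ?thesis using that h(2) q'(2)[of n] by (auto simp: p'_def)
  qed
  then have "hook n (p', q')" using q' assms(2) by (auto simp: hook_def p'_def)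
  moreover have "hook_step n pq (p', q')" using q' by (auto simp: pq hook_step_def p'_def)
  ultimately show ?thesis by blast
qed

lemma hook_step_exists_backward:
  assumes "hook n pq'" "1 \<le> n"
  shows "\<exists>pq. hook n pq \<and> hook_step n pq pq'"
proof -
  obtain p' q' where pq': "pq' = (p', q')" by (cases pq')
  have h: "p' 0 = q' 0" "p' n = q' n" "\<And>i. i < n \<Longrightarrow> interlace (p' i) (p' (Suc i))"
    "\<And>i. i < n \<Longrightarrow> interlace (q' i) (q' (Suc i))" using assms(1) by (auto simp: pq' hook_def)
  have "interlace (p' (n - 1)) (q' n)" using h(2) h(3)[of "n - 1"] assms(2) by simp
  then obtain q where q: "q n = p' (n - 1)" "\<And>y. y \<le> n \<Longrightarrow> interlace (q y) (q' y)"
    "\<And>y. y < n \<Longrightarrow> interlace (q y) (q (Suc y)) \<and> local_rule (q y) (q' y) (q (Suc y)) (q' (Suc y))"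
    using column_backward[of n q' "p' (n - 1)"] h(4) by blast
  define p where "p i = (if i = 0 then q 0 else p' (i - 1))" for i
  have "interlace (p i) (p (Suc i))" if "i < n" for i
  proof (cases i)
    case 0
    then show ?thesis using q(2)[of 0] h(1) by (simp add: p_def)
  next
    case (Suc m)
    then show ?thesis using h(3)[of m] that by (simp add: p_def)
  qed
  then have "hook n (p, q)" using q assms(2) by (auto simp: hook_def p_def)
  moreover have "hook_step n (p, q) pq'" using q by (auto simp: pq' hook_step_def p_def)
  ultimately show ?thesis by blast
qed

lemma cylinder_field_exists:
  assumes PQ: "PQ \<in> SST_pairs n" and n: "1 \<le> n"
  shows "\<exists>F. cylinder_field n F \<and> boundary n F = PQ"
proof -
  obtain P Q \<rho> l where PQ_eq: "PQ = (P, Q)" and P: "P \<in> SST \<rho> l n" and Q: "Q \<in> SST \<rho> l n"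
    using PQ unfolding SST_pairs_def by auto
  have "hook n ((!) P, (!) Q)" using P Q by (auto simp: hook_def SST_def)
  then obtain s where s0: "s 0 = ((!) P, (!) Q)" and s: "\<And>k :: int. hook n (s k)"
    "\<And>k. hook_step n (s k) (s (k + 1))"
    using bi_infinite_orbit[of "hook n" "hook_step n" "((!) P, (!) Q)"]
      hook_step_exists[OF _ n] hook_step_exists_backward[OF _ n] by blast
  define p where "p k = fst (s k)" for k
  define q where "q k = snd (s k)" for k
  have sk: "s k = (p k, q k)" for k by (simp add: p_def q_def)
  have h: "p k 0 = q k 0" "p k n = q k n" "\<And>i. i < n \<Longrightarrow> interlace (q k i) (q k (Suc i))" for k
    using s(1)[of k] by (auto simp: sk hook_def)
  have st: "\<And>i. i < n \<Longrightarrow> p (k + 1) i = p k (Suc i)" "\<And>y. y \<le> n \<Longrightarrow> interlace (q k y) (q (k + 1) y)"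
    "\<And>y. y < n \<Longrightarrow> local_rule (q k y) (q (k + 1) y) (q k (Suc y)) (q (k + 1) (Suc y))" for k
    using s(2)[of k] by (auto simp: sk hook_step_def)
  \<comment> \<open>Repeated shifts turn the horizontal arm into the bottom entries of the following
    columns, so the columns alone carry the field.\<close>
  have p_shift: "p k i = q (k + int i) 0" if "i \<le> n" for k i
    using that
  proof (induction i arbitrary: k)
    case (Suc i)
    then show ?case using st(1)[of i k] Suc.IH[of "k + 1"] by (simp add: add_ac)
  qed (simp add: h(1))
  \<comment> \<open>A point at height \<open>y = n * m + r\<close> is equivalent to the one at
    height \<open>r\<close> in column \<open>x + n * m\<close>.\<close>
  define F where "F = (\<lambda>(x, y). q (x + int n * (y div int n)) (nat (y mod int n)))"
  \<comment> \<open>The formula is extended to \<open>r = n\<close>, for squares that straddle two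
    strips: the top of a column is the end of its horizontal arm, hence the bottom of the column
    \<open>n\<close> steps further.\<close>
  have F: "F (x, int n * m + int r) = q (x + int n * m) r" if "r \<le> n" for x m r
  proof (cases "r = n")
    case True
    have "int n * m + int n = int n * (m + 1)" by (simp add: algebra_simps)
    then have "F (x, int n * m + int r) = q (x + int n * m + int n) 0"
      using n True by (simp add: F_def algebra_simps)
    also have "\<dots> = q (x + int n * m) n" using p_shift[of n "x + int n * m"] h(2) by simp
    finally show ?thesis using True by simp
  next
    case False
    then show ?thesis using that n by (simp add: F_def)
  qed
  have "cylinder_field n F"
    unfolding cylinder_field_def
  proof (intro allI)
    fix x y
    define m where "m = y div int n"
    define r where "r = nat (y mod int n)"
    have r: "r < n" and y: "y = int n * m + int r" using n by (simp_all add: r_def m_def nat_less_iff)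
    have y1: "y + 1 = int n * m + int (Suc r)" using y by simp
    have *: "(y - int n) div int n = y div int n - 1" "(y - int n) mod int n = y mod int n"
      using n div_mult_self1[of "int n" y "-1"] by simp_all
    have "x + int n + int n * (y div int n - 1) = x + int n * (y div int n)"
      by (simp add: algebra_simps)
    then have "F (x + int n, y - int n) = F (x, y)" by (simp only: F_def prod.case *)
    moreover have "F (x, y) = q (x + int n * m) r" "F (x + 1, y) = q (x + int n * m + 1) r"
      "F (x, y + 1) = q (x + int n * m) (Suc r)" "F (x + 1, y + 1) = q (x + int n * m + 1) (Suc r)"
      using F[of r x m] F[of r "x + 1" m] F[of "Suc r" x m] F[of "Suc r" "x + 1" m] r
      unfolding y1 y by (simp_all add: algebra_simps)
    ultimately show "F (x + int n, y - int n) = F (x, y) \<and>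
        interlace (F (x, y)) (F (x + 1, y)) \<and> interlace (F (x, y)) (F (x, y + 1)) \<and>
        local_rule (F (x, y)) (F (x + 1, y)) (F (x, y + 1)) (F (x + 1, y + 1))"
      using st(2)[of r "x + int n * m"] st(3)[of r "x + int n * m"] h(3)[of r "x + int n * m"] r
      by (simp add: add_ac)
  qed
  moreover have "boundary n F = PQ"
  proof -
    have len: "length P = n + 1" "length Q = n + 1" using P Q by (auto simp: SST_def)
    have "F (0, int i) = Q ! i" if "i \<le> n" for i using F[of i 0 0] that by (simp add: q_def s0)
    moreover have "F (int i, 0) = P ! i" if "i \<le> n" for i
      using F[of 0 "int i" 0] p_shift[OF that, of 0] by (simp add: p_def s0)
    ultimately show ?thesis
      unfolding PQ_eq boundary_def using len by (auto intro!: nth_equalityI simp del: upt_Suc)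
  qed
  ultimately show ?thesis by blast
qed

lemma field_of_boundary:
  assumes F: "cylinder_field n F" and n: "1 \<le> n"
  shows "field_of n (boundary n F) = F"
proof -
  let ?P = "map (\<lambda>i. F (int i, 0)) [0..<n+1]" and ?Q = "map (\<lambda>i. F (0, int i)) [0..<n+1]"
  have "(THE G. Fomin_field n (length (?P ! 0)) G \<and> (\<forall>i\<le>n. G (int i, 0) = ?P ! i \<and> G (0, int i) = ?Q ! i)) = F"
  proof (rule the_equality)
    show "Fomin_field n (length (?P ! 0)) F \<and> (\<forall>i\<le>n. F (int i, 0) = ?P ! i \<and> F (0, int i) = ?Q ! i)"
      using F by (auto simp: Fomin_field_iff simp del: upt_Suc)
  next
    fix G assume G: "Fomin_field n (length (?P ! 0)) G \<and> (\<forall>i\<le>n. G (int i, 0) = ?P ! i \<and> G (0, int i) = ?Q ! i)"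
    then have "G (int i, 0) = F (int i, 0)" "G (0, int i) = F (0, int i)" if "i \<le> n" for i
      using that by (auto simp: less_Suc_eq_le simp del: upt_Suc)
    then have "boundary n G = boundary n F" by (auto simp: boundary_def)
    then show "G = F" using cylinder_field_unique[OF _ F n] G by (auto simp: Fomin_field_iff)
  qed
  then show ?thesis by (simp add: field_of_def boundary_def)
qed

section \<open>The maps on tableau pairs as translations of fields\<close>

definition translate :: "int \<Rightarrow> int \<Rightarrow> (int \<times> int \<Rightarrow> int list) \<Rightarrow> int \<times> int \<Rightarrow> int list" where
  "translate a b F = (\<lambda>(x, y). F (x + a, y + b))"

lemma translate_translate: "translate a b (translate c d F) = translate (a + c) (b + d) F"
  by (simp add: translate_def fun_eq_iff add_ac)

lemma translate_field:
  assumes "cylinder_field n F"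
  shows "cylinder_field n (translate a b F)"
  using cylinder_fieldD[OF assms, of "_ + a" "_ + b"]
  by (simp add: cylinder_field_def translate_def algebra_simps)

definition transpose_field :: "(int \<times> int \<Rightarrow> int list) \<Rightarrow> int \<times> int \<Rightarrow> int list" where
  "transpose_field F = (\<lambda>(x, y). F (y, x))"

lemma cylinder_field_transpose:
  assumes "cylinder_field n F"
  shows "cylinder_field n (transpose_field F)"
proof -
  have "F (y - int n, x + int n) = F (y, x)" for x y
    using cylinder_fieldD(1)[OF assms, of "y - int n" "x + int n"] by simp
  then show ?thesis
    using cylinder_fieldD(2-4)[OF assms] by (simp add: cylinder_field_def transpose_field_def local_rule_sym)
qed

text \<open>Each of the first three maps reads the same field along another hook, with corner
  \<open>(1, 0)\<close>, \<open>(0, 1)\<close> or \<open>(n, 0)\<close>; swapping reflects the field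
  in the diagonal.\<close>

lemma boundary_maps:
  assumes "cylinder_field n F" "1 \<le> n"
  shows "iota1 n (boundary n F) = boundary n (translate 1 0 F)"
    "iota2 n (boundary n F) = boundary n (translate 0 1 F)"
    "cRSK n (boundary n F) = boundary n (translate (int n) 0 F)"
    "prod.swap (boundary n F) = boundary n (transpose_field F)"
  unfolding iota1_def iota2_def cRSK_def field_of_boundary[OF assms]
  by (simp_all add: boundary_def translate_def transpose_field_def add.commute del: upt_Suc)

section \<open>Operators on fields\<close>

text \<open>The definite description is meaningful only where a lowering row exists;
  \<open>lowerable\<close> guards its use.\<close>

definition lowered :: "int list \<Rightarrow> int list \<Rightarrow> int list \<Rightarrow> int list" where
  "lowered \<kappa> \<mu> \<nu> = (let r = THE r. f_row \<kappa> \<mu> \<nu> r in \<mu>[r := \<mu> ! r - 1])"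

lemma lowered_eq: "f_row \<kappa> \<mu> \<nu> r \<Longrightarrow> lowered \<kappa> \<mu> \<nu> = \<mu>[r := \<mu> ! r - 1]"
  unfolding lowered_def Let_def using f_row_unique by (metis the_equality)

definition lowerable :: "(int \<times> int \<Rightarrow> int list) \<Rightarrow> int \<Rightarrow> int \<Rightarrow> bool" where
  "lowerable F x y \<longleftrightarrow> (\<exists>r. f_row (F (x - 1, y)) (F (x, y)) (F (x + 1, y)) r)"

definition lower_field :: "nat \<Rightarrow> nat \<Rightarrow> (int \<times> int \<Rightarrow> int list) \<Rightarrow> int \<times> int \<Rightarrow> int list" where
  "lower_field n i F = (\<lambda>(x, y). if x mod int n = int i mod int n
     then lowered (F (x - 1, y)) (F (x, y)) (F (x + 1, y)) else F (x, y))"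

lemma two_squares_field:
  assumes "cylinder_field n F"
  shows "two_squares (F (x - 1, y)) (F (x, y)) (F (x + 1, y))
    (F (x - 1, y + 1)) (F (x, y + 1)) (F (x + 1, y + 1))"
proof
  note D = cylinder_fieldD[OF assms]
  show "interlace (F (x - 1, y)) (F (x, y))" using D(2)[of "x - 1" y] by simp
  show "local_rule (F (x - 1, y)) (F (x, y)) (F (x - 1, y + 1)) (F (x, y + 1))"
    using D(4)[of "x - 1" y] by simp
qed (rule cylinder_fieldD[OF assms])+

text \<open>The two transport lemmas give one direction each, so being lowerable is a property of
  whole columns.\<close>

lemma lowerable_step:
  assumes "cylinder_field n F"
  shows "lowerable F x (y + 1) \<longleftrightarrow> lowerable F x y"
proof -
  interpret two_squares "F (x - 1, y)" "F (x, y)" "F (x + 1, y)"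
    "F (x - 1, y + 1)" "F (x, y + 1)" "F (x + 1, y + 1)"
    using two_squares_field[OF assms] .
  show ?thesis unfolding lowerable_def using f_row_forward f_row_defined_backward by blast
qed

lemma lowerable_column:
  assumes "cylinder_field n F"
  shows "lowerable F x y \<longleftrightarrow> lowerable F x 0"
proof (induction y rule: int_induct[where k = 0])
  case (step1 y)
  then show ?case using lowerable_step[OF assms, of x y] by simp
next
  case (step2 y)
  then show ?case using lowerable_step[OF assms, of x "y - 1"] by simp
qed simp

text \<open>On the cylinder a horizontal shift by \<open>k * n\<close> is a vertical one, along
  which lowerability does not change.\<close>

lemma lowerable_translate:
  assumes "cylinder_field n F"
  shows "lowerable (translate (k * int n) 0 F) x 0 \<longleftrightarrow> lowerable F x 0"
proof -
  have "F (x' + k * int n, 0) = F (x', k * int n)" for x'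
    using cylinder_field_periodic[OF assms, of x' k "k * int n"] by simp
  from this[of "x - 1"] this[of x] this[of "x + 1"]
  have "lowerable (translate (k * int n) 0 F) x 0 \<longleftrightarrow> lowerable F x (k * int n)"
    unfolding lowerable_def translate_def by (simp add: algebra_simps)
  then show ?thesis using lowerable_column[OF assms] by simp
qed

lemma lowerable_mod:
  assumes F: "cylinder_field n F" and "lowerable F (int i) 0" "x mod int n = int i mod int n"
  shows "lowerable F x y"
proof -
  obtain k where k: "x = int i + k * int n"
    using assms(3) by (metis add.commute mod_eqE mult.commute)
  have "lowerable (translate (k * int n) 0 F) (int i) 0"
    using assms(2) lowerable_translate[OF F] by simp
  then have "lowerable F x 0" unfolding lowerable_def translate_def k by (simp add: algebra_simps)
  then show ?thesis using lowerable_column[OF F, of x y] by simp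
qed

text \<open>\<open>G\<close> is the lowered column. By uniqueness of the lowering row,
  \<open>G (y + 1)\<close> is the signature produced by \<open>f_row_forward\<close>, so the squares
  on both sides keep the rule while the outer columns stay fixed.\<close>

lemma lowered_square:
  assumes F: "cylinder_field n F" and "lowerable F x y"
  defines "G \<equiv> \<lambda>y. lowered (F (x - 1, y)) (F (x, y)) (F (x + 1, y))"
  shows "interlace (F (x - 1, y)) (G y)" "interlace (G y) (F (x + 1, y))" "interlace (G y) (G (y + 1))"
    "local_rule (F (x - 1, y)) (G y) (F (x - 1, y + 1)) (G (y + 1))"
    "local_rule (G y) (F (x + 1, y)) (G (y + 1)) (F (x + 1, y + 1))"
proof -
  interpret two_squares "F (x - 1, y)" "F (x, y)" "F (x + 1, y)"
    "F (x - 1, y + 1)" "F (x, y + 1)" "F (x + 1, y + 1)"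
    using two_squares_field[OF F] .
  obtain r where r: "f_row (F (x - 1, y)) (F (x, y)) (F (x + 1, y)) r"
    using assms(2) unfolding lowerable_def by blast
  then have G: "G y = (F (x, y))[r := F (x, y) ! r - 1]" by (simp add: G_def lowered_eq)
  show 1: "interlace (F (x - 1, y)) (G y)" and "interlace (G y) (F (x + 1, y))"
    unfolding G using f_row_interlace[OF k01 k12 r] by blast+
  obtain r' where r': "f_row (F (x - 1, y + 1)) (F (x, y + 1)) (F (x + 1, y + 1)) r'"
    "local_rule (F (x - 1, y)) (G y) (F (x - 1, y + 1)) ((F (x, y + 1))[r' := F (x, y + 1) ! r' - 1])"
    "local_rule (G y) (F (x + 1, y)) ((F (x, y + 1))[r' := F (x, y + 1) ! r' - 1]) (F (x + 1, y + 1))"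
    using f_row_forward[OF r] unfolding G by blast
  then have G1: "G (y + 1) = (F (x, y + 1))[r' := F (x, y + 1) ! r' - 1]" by (simp add: G_def lowered_eq)
  show rule: "local_rule (F (x - 1, y)) (G y) (F (x - 1, y + 1)) (G (y + 1))"
    and "local_rule (G y) (F (x + 1, y)) (G (y + 1)) (F (x + 1, y + 1))"
    unfolding G1 by (rule r')+
  show "interlace (G y) (G (y + 1))" using local_rule_interlace(1)[OF 1 left rule] .
qed

text \<open>As \<open>n\<close> is at least 2, no two adjacent columns are congruent to
  \<open>i\<close>; each square therefore has at most one lowered side.\<close>

lemma lower_field_cylinder_field:
  assumes F: "cylinder_field n F" and i: "lowerable F (int i) 0" and n: "2 \<le> n"
  shows "cylinder_field n (lower_field n i F)"
  unfolding cylinder_field_def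
proof (intro allI conjI)
  fix x y
  note D = cylinder_fieldD[OF F]
  let ?L = "lower_field n i F"
  let ?on = "\<lambda>x. x mod int n = int i mod int n"
  have on: "?L (x, y) = lowered (F (x - 1, y)) (F (x, y)) (F (x + 1, y))" if "?on x" for x y
    using that by (simp add: lower_field_def)
  have off: "?L (x, y) = F (x, y)" if "\<not> ?on x" for x y
    using that by (simp add: lower_field_def)
  have adj: "\<not> (?on x \<and> ?on (x + 1))"
  proof
    assume "?on x \<and> ?on (x + 1)"
    then have "int n dvd (x + 1) - x" by (metis mod_eq_dvd_iff)
    then show False using n by simp
  qed
  have per: "F (x' + int n, y - int n) = F (x', y)" for x' by (rule D(1))
  have "?on (x + int n) \<longleftrightarrow> ?on x" by simp
  then show "?L (x + int n, y - int n) = ?L (x, y)"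
    using per[of "x - 1"] per[of x] per[of "x + 1"] by (simp add: lower_field_def algebra_simps)
  show "interlace (?L (x, y)) (?L (x + 1, y))"
  proof (cases "?on x")
    case True
    then show ?thesis
      using lowered_square(2)[OF F lowerable_mod[OF F i True]] adj by (simp add: on off)
  next
    case False
    then show ?thesis
      using D(2)[of x y] lowered_square(1)[OF F lowerable_mod[OF F i], of "x + 1" y]
      by (cases "?on (x + 1)") (simp_all add: on off)
  qed
  show "interlace (?L (x, y)) (?L (x, y + 1))"
    using lowered_square(3)[OF F lowerable_mod[OF F i], of x y] D(3)[of x y]
    by (cases "?on x") (simp_all add: on off)
  show "local_rule (?L (x, y)) (?L (x + 1, y)) (?L (x, y + 1)) (?L (x + 1, y + 1))"
  proof (cases "?on x")
    case True
    then show ?thesis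
      using lowered_square(5)[OF F lowerable_mod[OF F i True]] adj by (simp add: on off)
  next
    case False
    then show ?thesis
      using D(4)[of x y] lowered_square(4)[OF F lowerable_mod[OF F i], of "x + 1" y]
      by (cases "?on (x + 1)") (simp_all add: on off)
  qed
qed

text \<open>Among the columns 0 to \<open>n\<close> only column \<open>i\<close> is congruent to
  \<open>i\<close>. So the first tableau changes in one member, and the second, which lies in column
  0, does not change.\<close>

lemma kash_f_boundary:
  assumes F: "cylinder_field n F" and i: "1 \<le> i" "i < n"
  shows "on_fst (kash_f n i) (boundary n F) =
    (if lowerable F (int i) 0 then Some (boundary n (lower_field n i F)) else None)"
proof -
  let ?P = "fst (boundary n F)"
  have "?P \<in> SST (F (0, 0)) (F (int n, 0)) n"
  proof -
    obtain \<rho> l where "?P \<in> SST \<rho> l n"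
      using boundary_SST_pairs[OF F] unfolding SST_pairs_def by auto
    moreover from this have "\<rho> = ?P ! 0" "l = ?P ! n" by (auto simp: SST_def)
    ultimately show ?thesis by (simp add: boundary_def nth_append del: upt_Suc)
  qed
  then interpret tableau n "F (0, 0)" "F (int n, 0)" ?P by unfold_locales
  have P: "?P ! m = F (int m, 0)" if "m \<le> n" for m
    using that by (simp add: boundary_def less_Suc_eq_le del: upt_Suc)
  have P_nths: "?P ! (i - 1) = F (int i - 1, 0)" "?P ! i = F (int i, 0)" "?P ! (i + 1) = F (int i + 1, 0)"
    using P[of "i - 1"] P[of i] P[of "i + 1"] i by (simp_all add: of_nat_diff add.commute)
  note iff = kash_f_eq_Some_iff[OF i, unfolded P_nths]
  show ?thesis
  proof (cases "lowerable F (int i) 0")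
    case True
    then obtain r where r: "f_row (F (int i - 1, 0)) (F (int i, 0)) (F (int i + 1, 0)) r"
      unfolding lowerable_def by blast
    then have "kash_f n i ?P = Some (?P[i := (F (int i, 0))[r := F (int i, 0) ! r - 1]])"
      unfolding iff by blast
    also have "(F (int i, 0))[r := F (int i, 0) ! r - 1] = lower_field n i F (int i, 0)"
      using r by (simp add: lower_field_def lowered_eq)
    also have "?P[i := lower_field n i F (int i, 0)] = fst (boundary n (lower_field n i F))"
    proof (rule nth_equalityI)
      fix m assume "m < length (?P[i := lower_field n i F (int i, 0)])"
      then have m: "m \<le> n" using length_P by simp
      have "int m mod int n \<noteq> int i mod int n" if "m \<noteq> i"
        using that m i by (cases "m = n") (auto simp: zmod_int[symmetric])
      then show "?P[i := lower_field n i F (int i, 0)] ! m = fst (boundary n (lower_field n i F)) ! m"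
        using m i P[OF m] length_P
        by (cases "m = i") (auto simp: boundary_def less_Suc_eq_le lower_field_def simp del: upt_Suc)
    qed (simp add: boundary_def)
    finally have "kash_f n i ?P = Some (fst (boundary n (lower_field n i F)))" .
    moreover have "snd (boundary n (lower_field n i F)) = snd (boundary n F)"
      using i by (simp add: boundary_def lower_field_def del: upt_Suc)
    ultimately show ?thesis using True by (simp add: on_fst_def prod_eq_iff)
  next
    case False
    then have "kash_f n i ?P = None"
      using iff unfolding lowerable_def by (meson not_None_eq)
    then show ?thesis using False by (simp add: on_fst_def)
  qed
qed

lemma lower_field_translate:
  "lower_field n i (translate (int n) 0 F) = translate (int n) 0 (lower_field n i F)"
  by (auto simp: lower_field_def translate_def fun_eq_iff algebra_simps)

text \<open>The closure clause lets a commutation pass to partial inverses, conjugates and the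
  second component.\<close>

definition commutes_on :: "'a set \<Rightarrow> ('a \<Rightarrow> 'a) \<Rightarrow> ('a \<Rightarrow> 'a option) \<Rightarrow> bool" where
  "commutes_on S c G \<longleftrightarrow> (\<forall>a\<in>S. map_option c (G a) = G (c a) \<and> set_option (G a) \<subseteq> S)"

lemma commutes_on_inverse:
  assumes c: "bij_betw c S S" and G: "commutes_on S c G"
    and inv: "\<And>a b. a \<in> S \<Longrightarrow> H a = Some b \<Longrightarrow> b \<in> S \<and> G b = Some a"
      "\<And>a b. a \<in> S \<Longrightarrow> G a = Some b \<Longrightarrow> H b = Some a"
  shows "commutes_on S c H"
  unfolding commutes_on_def
proof (intro ballI conjI)
  fix a assume a: "a \<in> S"
  then have ca: "c a \<in> S" using c by (auto simp: bij_betw_def)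
  show "set_option (H a) \<subseteq> S" using inv(1)[OF a] by auto
  show "map_option c (H a) = H (c a)"
  proof (cases "H a")
    case (Some b)
    then have b: "b \<in> S" "G b = Some a" using inv(1)[OF a] by auto
    then have "G (c b) = Some (c a)" using G by (metis commutes_on_def option.simps(9))
    moreover have "c b \<in> S" using b c by (auto simp: bij_betw_def)
    ultimately show ?thesis using inv(2) Some by simp
  next
    case None
    \<comment> \<open>If \<open>H\<close> were defined at \<open>c a\<close>, surjectivity of
      \<open>c\<close> would write its value as \<open>c b\<close>; injectivity would then give
      \<open>G b = Some a\<close>, and \<open>H\<close> would be defined at
      \<open>a\<close>.\<close>
    have "H (c a) = None"
    proof (rule ccontr)
      assume "H (c a) \<noteq> None"
      then obtain d where "H (c a) = Some d" by blast
      then have d: "d \<in> S" "G d = Some (c a)" using inv(1)[OF ca] by auto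
      then obtain b where b: "b \<in> S" "d = c b" using c unfolding bij_betw_def by blast
      then have "map_option c (G b) = Some (c a)" "set_option (G b) \<subseteq> S"
        using G d by (auto simp: commutes_on_def)
      then obtain a' where a': "G b = Some a'" "c a' = c a" "a' \<in> S" by (cases "G b") auto
      then have "a' = a" using c a by (auto simp: bij_betw_def inj_on_def)
      then show False using inv(2)[OF b(1)] a' None by simp
    qed
    then show ?thesis using None by simp
  qed
qed

lemma commutes_on_conjugate:
  assumes \<iota>: "bij_betw \<iota> (SST_pairs n) (SST_pairs n)"
    and c: "\<And>a. a \<in> SST_pairs n \<Longrightarrow> c a \<in> SST_pairs n \<and> c (\<iota> a) = \<iota> (c a)"
    and G: "commutes_on (SST_pairs n) c G"
  shows "commutes_on (SST_pairs n) c (conjugate_by n \<iota> G)"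
  unfolding commutes_on_def
proof (intro ballI)
  have \<iota>_mem: "\<iota> a \<in> SST_pairs n" if "a \<in> SST_pairs n" for a using that \<iota> by (auto simp: bij_betw_def)
  \<comment> \<open>Injectivity of \<open>\<iota>\<close> lets \<open>inv_into\<close> cancel it,
    and surjectivity brings every argument into this form.\<close>
  have conj: "conjugate_by n \<iota> G (\<iota> a) = map_option \<iota> (G a)" if "a \<in> SST_pairs n" for a
    using that \<iota> by (simp add: conjugate_by_def bij_betw_def)
  fix b assume "b \<in> SST_pairs n"
  then obtain a where a: "a \<in> SST_pairs n" and b: "b = \<iota> a" using \<iota> unfolding bij_betw_def by blast
  have Ga: "map_option c (G a) = G (c a)" "set_option (G a) \<subseteq> SST_pairs n"
    using G a by (auto simp: commutes_on_def)
  have "map_option c (map_option \<iota> (G a)) = map_option \<iota> (map_option c (G a))"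
    using Ga(2) c by (cases "G a") auto
  then have "map_option c (conjugate_by n \<iota> G b) = conjugate_by n \<iota> G (c b)"
    using a c[OF a] Ga(1) by (simp add: b conj)
  moreover have "set_option (conjugate_by n \<iota> G b) \<subseteq> SST_pairs n"
    using Ga(2) \<iota>_mem a by (auto simp: b conj option.set_map)
  ultimately show "map_option c (conjugate_by n \<iota> G b) = conjugate_by n \<iota> G (c b) \<and>
      set_option (conjugate_by n \<iota> G b) \<subseteq> SST_pairs n" ..
qed

lemma on_snd_eq: "on_snd g = (\<lambda>a. map_option prod.swap (on_fst g (prod.swap a)))"
  by (simp add: on_snd_def on_fst_def option.map_comp comp_def fun_eq_iff)

lemma commutes_on_snd:
  assumes c: "\<And>a. a \<in> SST_pairs n \<Longrightarrow> c a \<in> SST_pairs n \<and> c (prod.swap a) = prod.swap (c a)"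
    and G: "commutes_on (SST_pairs n) c (on_fst g)"
  shows "commutes_on (SST_pairs n) c (on_snd g)"
  unfolding commutes_on_def
proof (intro ballI)
  have swap: "prod.swap a \<in> SST_pairs n" if "a \<in> SST_pairs n" for a
    using that unfolding SST_pairs_def by (cases a) (simp, blast)
  fix a assume "a \<in> SST_pairs n"
  then have a: "prod.swap a \<in> SST_pairs n" "c (prod.swap a) = prod.swap (c a)" using swap c by auto
  then have Ga: "map_option c (on_fst g (prod.swap a)) = on_fst g (prod.swap (c a))"
    "set_option (on_fst g (prod.swap a)) \<subseteq> SST_pairs n" using G by (auto simp: commutes_on_def)
  have "map_option c (on_snd g a) = map_option prod.swap (map_option c (on_fst g (prod.swap a)))"
    using Ga(2) c by (cases "on_fst g (prod.swap a)") (auto simp: on_snd_eq)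
  moreover have "set_option (on_snd g a) \<subseteq> SST_pairs n"
    using Ga(2) swap by (auto simp: on_snd_eq option.set_map)
  ultimately show "map_option c (on_snd g a) = on_snd g (c a) \<and> set_option (on_snd g a) \<subseteq> SST_pairs n"
    by (simp add: Ga(1) on_snd_eq)
qed

section \<open>Commutation of cRSK with all operators\<close>

context
  fixes n :: nat
  assumes n: "2 \<le> n"
begin

lemma SST_pairs_cases:
  assumes "a \<in> SST_pairs n"
  obtains F where "cylinder_field n F" "a = boundary n F"
  using cylinder_field_exists[OF assms] n by auto

text \<open>Translation by the opposite vector inverts the map on fields, and a field is determined
  by its boundary.\<close>

lemma bij_translate:
  assumes \<phi>: "\<And>F. cylinder_field n F \<Longrightarrow> \<phi> (boundary n F) = boundary n (translate a b F)"
  shows "bij_betw \<phi> (SST_pairs n) (SST_pairs n)"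
proof -
  have 0: "translate 0 0 F = F" for F by (simp add: translate_def)
  have "\<phi> p \<in> SST_pairs n" if "p \<in> SST_pairs n" for p
    using that by (elim SST_pairs_cases) (simp add: \<phi> boundary_SST_pairs translate_field)
  moreover have "inj_on \<phi> (SST_pairs n)"
  proof (rule inj_onI)
    fix p q assume pq: "p \<in> SST_pairs n" "q \<in> SST_pairs n" "\<phi> p = \<phi> q"
    obtain F where F: "cylinder_field n F" "p = boundary n F" using pq(1) by (rule SST_pairs_cases)
    obtain G where G: "cylinder_field n G" "q = boundary n G" using pq(2) by (rule SST_pairs_cases)
    have "translate a b F = translate a b G"
      using pq(3) F G n by (intro cylinder_field_unique[of n]) (simp_all add: \<phi> translate_field)
    then have "translate (-a) (-b) (translate a b F) = translate (-a) (-b) (translate a b G)" by simp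
    then show "p = q" using F G by (simp add: translate_translate 0)
  qed
  moreover have "q \<in> \<phi> ` SST_pairs n" if "q \<in> SST_pairs n" for q
  proof -
    obtain G where G: "cylinder_field n G" "q = boundary n G" using \<open>q \<in> SST_pairs n\<close> by (rule SST_pairs_cases)
    then have "q = \<phi> (boundary n (translate (-a) (-b) G))"
      by (simp add: \<phi> translate_field translate_translate 0)
    then show ?thesis using boundary_SST_pairs translate_field G(1) by blast
  qed
  ultimately show ?thesis unfolding bij_betw_def by blast
qed

lemma boundary_maps_n:
  assumes "cylinder_field n F"
  shows "iota1 n (boundary n F) = boundary n (translate 1 0 F)"
    "iota2 n (boundary n F) = boundary n (translate 0 1 F)"
    "cRSK n (boundary n F) = boundary n (translate (int n) 0 F)"
    "prod.swap (boundary n F) = boundary n (transpose_field F)"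
  using boundary_maps[OF assms] n by simp_all

lemmas bij_iota1 = bij_translate[OF boundary_maps_n(1)]
lemmas bij_iota2 = bij_translate[OF boundary_maps_n(2)]
lemmas bij_cRSK = bij_translate[OF boundary_maps_n(3)]

lemma cRSK_mem: "a \<in> SST_pairs n \<Longrightarrow> cRSK n a \<in> SST_pairs n"
  using bij_cRSK by (auto simp: bij_betw_def)

lemma cRSK_iota:
  assumes "a \<in> SST_pairs n"
  shows "cRSK n (iota1 n a) = iota1 n (cRSK n a)" "cRSK n (iota2 n a) = iota2 n (cRSK n a)"
  using assms by (elim SST_pairs_cases; simp add: boundary_maps_n translate_field translate_translate add.commute)+

text \<open>Transposition turns the shift by \<open>(n, 0)\<close> into the one by
  \<open>(0, n)\<close>, and periodicity identifies the two.\<close>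

lemma cRSK_swap:
  assumes "a \<in> SST_pairs n"
  shows "cRSK n (prod.swap a) = prod.swap (cRSK n a)"
proof -
  obtain F where F: "cylinder_field n F" "a = boundary n F" using assms by (rule SST_pairs_cases)
  have "F (y, x + int n) = F (y + int n, x)" for x y
    using cylinder_fieldD(1)[OF F(1), of y "x + int n"] by simp
  then have "translate (int n) 0 (transpose_field F) = transpose_field (translate (int n) 0 F)"
    by (simp add: translate_def transpose_field_def fun_eq_iff)
  then show ?thesis
    by (simp add: F boundary_maps_n cylinder_field_transpose translate_field)
qed

text \<open>On fields both orders lower the same residue class of columns and translate by
  \<open>n\<close>, and translation does not affect whether lowering is possible.\<close>

lemma commutes_kash_f:
  assumes i: "1 \<le> i" "i < n"
  shows "commutes_on (SST_pairs n) (cRSK n) (on_fst (kash_f n i))"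
  unfolding commutes_on_def
proof (intro ballI)
  fix a assume "a \<in> SST_pairs n"
  then obtain F where F: "cylinder_field n F" "a = boundary n F" by (rule SST_pairs_cases)
  have "lowerable (translate (int n) 0 F) (int i) 0 \<longleftrightarrow> lowerable F (int i) 0"
    using lowerable_translate[OF F(1), of 1] by simp
  then show "map_option (cRSK n) (on_fst (kash_f n i) a) = on_fst (kash_f n i) (cRSK n a) \<and>
      set_option (on_fst (kash_f n i) a) \<subseteq> SST_pairs n"
    using F lower_field_cylinder_field[OF F(1) _ n]
    by (simp add: boundary_maps_n kash_f_boundary[OF _ i] translate_field lower_field_translate
        boundary_SST_pairs)
qed

lemma commutes_kash_e:
  assumes i: "1 \<le> i" "i < n"
  shows "commutes_on (SST_pairs n) (cRSK n) (on_fst (kash_e n i))"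
proof (rule commutes_on_inverse[OF bij_cRSK commutes_kash_f[OF i]])
  fix a b
  assume "a \<in> SST_pairs n"
  then obtain P Q \<rho> l where a: "a = (P, Q)" "P \<in> SST \<rho> l n" "Q \<in> SST \<rho> l n" "signature \<rho>" "signature l"
    unfolding SST_pairs_def by auto
  show "b \<in> SST_pairs n \<and> on_fst (kash_f n i) b = Some a" if "on_fst (kash_e n i) a = Some b"
    using that kash_e_SST[OF a(2) i] a by (auto simp: on_fst_def SST_pairs_def)
  show "on_fst (kash_e n i) b = Some a" if "on_fst (kash_f n i) a = Some b"
    using that kash_f_SST[OF a(2) i] a by (auto simp: on_fst_def)
qed

lemma commutes_operators:
  assumes "i < n" "G \<in> {E1 n i, F1 n i, E2 n i, F2 n i}"
  shows "commutes_on (SST_pairs n) (cRSK n) G"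
proof -
  have fst: "commutes_on (SST_pairs n) (cRSK n) (on_fst (kash_e n j))"
    "commutes_on (SST_pairs n) (cRSK n) (on_fst (kash_f n j))" if "1 \<le> j" "j < n" for j
    using that commutes_kash_e commutes_kash_f by blast+
  have snd: "commutes_on (SST_pairs n) (cRSK n) (on_snd (kash_e n j))"
    "commutes_on (SST_pairs n) (cRSK n) (on_snd (kash_f n j))" if "1 \<le> j" "j < n" for j
    using fst[OF that] commutes_on_snd[of n "cRSK n"] cRSK_mem cRSK_swap by blast+
  have "commutes_on (SST_pairs n) (cRSK n) (conjugate_by n (iota1 n) H)"
    "commutes_on (SST_pairs n) (cRSK n) (conjugate_by n (iota2 n) H)"
    if "commutes_on (SST_pairs n) (cRSK n) H" for H
    using that commutes_on_conjugate[OF bij_iota1] commutes_on_conjugate[OF bij_iota2] cRSK_mem cRSK_iota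
    by blast+
  then show ?thesis
    using assms n fst[of 1] snd[of 1] fst[of i] snd[of i]
    by (cases "i = 0") (auto simp: E1_def F1_def E2_def F2_def)
qed

end

theorem theorem6p9:
  fixes n :: nat
  assumes "n \<ge> 2"
  shows "bij_betw (cRSK n) (SST_pairs n) (SST_pairs n) \<and>
    (\<forall>i<n. \<forall>G\<in>{E1 n i, F1 n i, E2 n i, F2 n i}. \<forall>PQ\<in>SST_pairs n.
       map_option (cRSK n) (G PQ) = G (cRSK n PQ))"
proof (intro conjI allI impI ballI)
  show "bij_betw (cRSK n) (SST_pairs n) (SST_pairs n)" using assms by (rule bij_cRSK)
next
  fix i G PQ
  assume "i < n" "G \<in> {E1 n i, F1 n i, E2 n i, F2 n i}" "PQ \<in> SST_pairs n"
  then show "map_option (cRSK n) (G PQ) = G (cRSK n PQ)"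
    using commutes_operators[OF assms] unfolding commutes_on_def by blast
qed

end
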